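(* Let $\mathcal{C}_\infty$ be the set of all functions $\rho\in L^\infty_+(I^2,\mathbb{R})$ such that there is no bi-Lipschitz map $f:I^2\to\mathbb{R}^2$ satisfying $Jac(f)=\rho$ almost everywhere. Then $\mathcal{C}_\infty$ is a thick subset of $L^\infty_+(I^2,\mathbb{R})$.
   Context: $I^2=[0,1]\times[0,1]$ with Lebesgue measure. $L^\infty_+(I^2,\mathbb{R})=\{\rho\in L^\infty(I^2,\mathbb{R}) : \rho(x)>0 \text{ for a.e. } x\}$, with the metric induced by $\|\cdot\|_\infty$. A map $f:(X_1,d_1)\to(X_2,d_2)$ between metric spaces is $L$-bi-Lipschitz if $\frac1L d_1(x,y)\le d_2(f(x),f(y))\le L\,d_1(x,y)$ for all $x,y\in X_1$, and bi-Lipschitz if it is $L$-bi-Lipschitz for some $L\ge1$ (Euclidean metrics here). For a Lipschitz map $f:I^2\to\mathbb{R}^2$, $Jac(f)=\det Df$, defined almost everywhere by Rademacher's theorem. A subset $G$ of a metric space $M$ is thick if it contains a set of the form $\bigcap_{n\in\mathbb{N}}G_n$ with each $G_n$ an open dense subset of $M$. *)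

theory Defs
  imports "HOL-Analysis.Analysis" "HOL-Probability.Essential_Supremum"
begin

definition unit_square :: "(real^2) set"
  where "unit_square = {x. \<forall>i. 0 \<le> x $ i \<and> x $ i \<le> 1}"

abbreviation square_measure :: "(real^2) measure"
  where "square_measure \<equiv> lebesgue_on unit_square"

definition ess_bounded :: "(real^2 \<Rightarrow> real) \<Rightarrow> bool"
  where "ess_bounded f \<longleftrightarrow>
    f \<in> borel_measurable square_measure \<and> esssup square_measure (\<lambda>x. ereal \<bar>f x\<bar>) < \<infinity>"

lemma unit_square_eq_cbox: "unit_square = cbox 0 1"
  by (auto simp: unit_square_def mem_box_cart)

lemma unit_square_sets [measurable, simp]: "unit_square \<in> sets lebesgue"
  by (simp add: unit_square_eq_cbox)

lemma emeasure_square_measure: "emeasure square_measure (space square_measure) \<noteq> 0"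
proof -
  have "(\<Prod>b\<in>Basis. (1 - 0 :: real^2) \<bullet> b) = 1"
    by (intro prod.neutral) (auto simp: Basis_vec_def inner_axis)
  then show ?thesis
    by (simp add: emeasure_restrict_space unit_square_eq_cbox emeasure_lborel_cbox_eq
        Basis_vec_def inner_axis)
qed

lemma ess_bounded_measurable [measurable_dest]:
  "ess_bounded f \<Longrightarrow> f \<in> borel_measurable square_measure"
  by (simp add: ess_bounded_def)

lemma ess_bounded_iff:
  "ess_bounded f \<longleftrightarrow>
    f \<in> borel_measurable square_measure \<and> (\<exists>B. AE x in square_measure. \<bar>f x\<bar> \<le> B)"
proof (intro iffI conjI)
  assume f: "ess_bounded f"
  then show "f \<in> borel_measurable square_measure"
    by (simp add: ess_bounded_def)
  have "esssup square_measure (\<lambda>x. ereal \<bar>f x\<bar>) < \<infinity>"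
    using f by (simp add: ess_bounded_def)
  then obtain B where "esssup square_measure (\<lambda>x. ereal \<bar>f x\<bar>) < ereal B"
    using less_PInf_Ex_of_nat by auto
  then have "AE x in square_measure. \<bar>f x\<bar> \<le> B"
    using esssup_AE[of "\<lambda>x. ereal \<bar>f x\<bar>" square_measure]
    by (auto elim!: eventually_mono dest: order_le_less_trans)
  then show "\<exists>B. AE x in square_measure. \<bar>f x\<bar> \<le> B" ..
next
  assume f: "f \<in> borel_measurable square_measure \<and> (\<exists>B. AE x in square_measure. \<bar>f x\<bar> \<le> B)"
  then have [measurable]: "f \<in> borel_measurable square_measure" by simp
  from f obtain B where "AE x in square_measure. \<bar>f x\<bar> \<le> B" by blast
  then have "esssup square_measure (\<lambda>x. ereal \<bar>f x\<bar>) \<le> ereal B"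
    by (intro esssup_I) auto
  then show "ess_bounded f"
    using f by (auto simp: ess_bounded_def)
qed

lemma ess_bounded_const: "ess_bounded (\<lambda>x. c)"
  by (auto simp: ess_bounded_iff)

lemma ess_bounded_add:
  assumes "ess_bounded f" "ess_bounded g"
  shows "ess_bounded (\<lambda>x. f x + g x)"
proof -
  obtain B C where "AE x in square_measure. \<bar>f x\<bar> \<le> B" "AE x in square_measure. \<bar>g x\<bar> \<le> C"
    using assms by (auto simp: ess_bounded_iff)
  then have "AE x in square_measure. \<bar>f x + g x\<bar> \<le> B + C"
    by eventually_elim auto
  then show ?thesis
    using assms by (auto simp: ess_bounded_iff)
qed

lemma ess_bounded_cmult:
  assumes "ess_bounded f"
  shows "ess_bounded (\<lambda>x. c * f x)"
proof -
  obtain B where "AE x in square_measure. \<bar>f x\<bar> \<le> B"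
    using assms by (auto simp: ess_bounded_iff)
  then have "AE x in square_measure. \<bar>c * f x\<bar> \<le> \<bar>c\<bar> * B"
    by eventually_elim (auto simp: abs_mult intro: mult_left_mono)
  then show ?thesis
    using assms by (auto simp: ess_bounded_iff)
qed

lemma ess_bounded_minus:
  "ess_bounded f \<Longrightarrow> ess_bounded (\<lambda>x. - f x)"
  using ess_bounded_cmult[of f "-1"] by simp

lemma ess_bounded_diff:
  "ess_bounded f \<Longrightarrow> ess_bounded g \<Longrightarrow> ess_bounded (\<lambda>x. f x - g x)"
  using ess_bounded_add[OF _ ess_bounded_minus, of f g] by simp

text \<open>Representatives are total functions on the plane, but only their values on the square matter:
  \<^const>\<open>lebesgue_on\<close> restricts both measurability and the almost-everywhere quantifier to it.\<close>

quotient_type linf = "real^2 \<Rightarrow> real" / partial: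
  "\<lambda>f g. ess_bounded f \<and> ess_bounded g \<and> (AE x in square_measure. f x = g x)"
proof (rule part_equivpI)
  show "\<exists>f. ess_bounded f \<and> ess_bounded f \<and> (AE x in square_measure. f x = f x)"
    using ess_bounded_const[of 0] by auto
  show "symp (\<lambda>f g. ess_bounded f \<and> ess_bounded g \<and> (AE x in square_measure. f x = g x))"
    by (auto intro!: sympI elim!: eventually_mono)
  show "transp (\<lambda>f g. ess_bounded f \<and> ess_bounded g \<and> (AE x in square_measure. f x = g x))"
    by (rule transpI) (auto elim: eventually_elim2)
qed

definition ess_norm :: "(real^2 \<Rightarrow> real) \<Rightarrow> real"
  where "ess_norm f = real_of_ereal (esssup square_measure (\<lambda>x. ereal \<bar>f x\<bar>))"

lemma ereal_ess_norm:
  assumes "ess_bounded f"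
  shows "ereal (ess_norm f) = esssup square_measure (\<lambda>x. ereal \<bar>f x\<bar>)" "0 \<le> ess_norm f"
proof -
  have [measurable]: "f \<in> borel_measurable square_measure"
    using assms by (simp add: ess_bounded_def)
  have "esssup square_measure (\<lambda>x. 0::ereal) \<le> esssup square_measure (\<lambda>x. ereal \<bar>f x\<bar>)"
    by (rule esssup_mono) auto
  then have "0 \<le> esssup square_measure (\<lambda>x. ereal \<bar>f x\<bar>)"
    using esssup_const[OF emeasure_square_measure, of "0::ereal"] by simp
  with assms show "ereal (ess_norm f) = esssup square_measure (\<lambda>x. ereal \<bar>f x\<bar>)" "0 \<le> ess_norm f"
    by (auto simp: ess_norm_def ess_bounded_def ereal_real real_of_ereal_pos)
qed

lemma ess_norm_AE:
  "ess_bounded f \<Longrightarrow> AE x in square_measure. \<bar>f x\<bar> \<le> ess_norm f"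
  using esssup_AE[of "\<lambda>x. ereal \<bar>f x\<bar>" square_measure] ereal_ess_norm(1)[of f, symmetric]
  by simp

lemma ess_norm_le:
  assumes "ess_bounded f" "AE x in square_measure. \<bar>f x\<bar> \<le> c"
  shows "ess_norm f \<le> c"
proof -
  have [measurable]: "f \<in> borel_measurable square_measure"
    using assms by (simp add: ess_bounded_def)
  have "esssup square_measure (\<lambda>x. ereal \<bar>f x\<bar>) \<le> ereal c"
    using assms(2) by (intro esssup_I) auto
  then show ?thesis
    using ereal_ess_norm(1)[OF assms(1), symmetric] by simp
qed

lemma ess_norm_cong:
  assumes "ess_bounded f" "ess_bounded g" "AE x in square_measure. f x = g x"
  shows "ess_norm f = ess_norm g"
proof -
  have [measurable]: "f \<in> borel_measurable square_measure" "g \<in> borel_measurable square_measure"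
    using assms by (auto simp: ess_bounded_def)
  have "esssup square_measure (\<lambda>x. ereal \<bar>f x\<bar>) = esssup square_measure (\<lambda>x. ereal \<bar>g x\<bar>)"
    using assms(3) by (intro esssup_AE_cong) auto
  then show ?thesis
    by (simp add: ess_norm_def)
qed

instantiation linf :: real_vector
begin

lift_definition zero_linf :: linf is "\<lambda>x. 0"
  by (simp add: ess_bounded_const)

lift_definition plus_linf :: "linf \<Rightarrow> linf \<Rightarrow> linf" is "\<lambda>f g x. f x + g x"
  by (auto simp: ess_bounded_add elim: eventually_elim2)

lift_definition uminus_linf :: "linf \<Rightarrow> linf" is "\<lambda>f x. - f x"
  by (auto simp: ess_bounded_minus)

lift_definition minus_linf :: "linf \<Rightarrow> linf \<Rightarrow> linf" is "\<lambda>f g x. f x - g x"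
  by (auto simp: ess_bounded_diff elim: eventually_elim2)

lift_definition scaleR_linf :: "real \<Rightarrow> linf \<Rightarrow> linf" is "\<lambda>c f x. c * f x"
  by (auto simp: ess_bounded_cmult elim: eventually_mono)

instance
proof
  fix a b :: real and f g h :: linf
  show "f + g + h = f + (g + h)"
    by transfer (auto simp: ess_bounded_add algebra_simps)
  show "f + g = g + f"
    by transfer (auto simp: ess_bounded_add algebra_simps)
  show "0 + f = f"
    by transfer auto
  show "- f + f = 0"
    by transfer (auto simp: ess_bounded_const)
  show "f - g = f + - g"
    by transfer (auto simp: ess_bounded_diff)
  show "a *\<^sub>R (f + g) = a *\<^sub>R f + a *\<^sub>R g"
    by transfer (auto simp: ess_bounded_add ess_bounded_cmult distrib_left)
  show "(a + b) *\<^sub>R f = a *\<^sub>R f + b *\<^sub>R f"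
    by transfer (auto simp: ess_bounded_add ess_bounded_cmult distrib_right)
  show "a *\<^sub>R b *\<^sub>R f = (a * b) *\<^sub>R f"
    by transfer (auto simp: ess_bounded_cmult mult.assoc)
  show "1 *\<^sub>R f = f"
    by transfer auto
qed

end

instantiation linf :: real_normed_vector
begin

lift_definition norm_linf :: "linf \<Rightarrow> real" is ess_norm
  by (auto intro: ess_norm_cong)

definition dist_linf :: "linf \<Rightarrow> linf \<Rightarrow> real"
  where "dist_linf f g = norm (f - g)"

definition sgn_linf :: "linf \<Rightarrow> linf"
  where "sgn_linf f = f /\<^sub>R norm f"

definition uniformity_linf :: "(linf \<times> linf) filter"
  where "uniformity_linf = (INF e\<in>{0 <..}. principal {(f, g). dist f g < e})"

definition open_linf :: "linf set \<Rightarrow> bool"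
  where "open_linf U \<longleftrightarrow> (\<forall>f\<in>U. \<forall>\<^sub>F (f', g) in uniformity. f' = f \<longrightarrow> g \<in> U)"

instance
proof
  fix a :: real and f g :: linf
  show "dist f g = norm (f - g)"
    by (fact dist_linf_def)
  show "sgn f = f /\<^sub>R norm f"
    by (fact sgn_linf_def)
  show "uniformity = (INF e\<in>{0 <..}. principal {(f, g :: linf). dist f g < e})"
    by (fact uniformity_linf_def)
  show "\<And>U :: linf set. open U \<longleftrightarrow> (\<forall>f\<in>U. \<forall>\<^sub>F (f', g) in uniformity. f' = f \<longrightarrow> g \<in> U)"
    by (fact open_linf_def)
  show "norm f = 0 \<longleftrightarrow> f = 0"
  proof transfer
    fix f assume "ess_bounded f \<and> ess_bounded f \<and> (AE x in square_measure. f x = f x)"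
    then have f: "ess_bounded f" by simp
    have "AE x in square_measure. f x = 0" if "ess_norm f = 0"
      using ess_norm_AE[OF f] that by auto
    moreover have "ess_norm f = 0" if "AE x in square_measure. f x = 0"
    proof -
      have "AE x in square_measure. \<bar>f x\<bar> \<le> 0"
        using that by eventually_elim simp
      then show ?thesis
        using ess_norm_le[OF f] ereal_ess_norm(2)[OF f] by (simp add: antisym)
    qed
    ultimately show "ess_norm f = 0 \<longleftrightarrow>
        ess_bounded f \<and> ess_bounded (\<lambda>x. 0) \<and> (AE x in square_measure. f x = 0)"
      using f by (auto simp: ess_bounded_const)
  qed
  show "norm (f + g) \<le> norm f + norm g"
  proof (transfer, elim conjE)
    fix f g assume f: "ess_bounded f" and g: "ess_bounded g"
    have "AE x in square_measure. \<bar>f x + g x\<bar> \<le> ess_norm f + ess_norm g"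
      using ess_norm_AE[OF f] ess_norm_AE[OF g] by eventually_elim auto
    then show "ess_norm (\<lambda>x. f x + g x) \<le> ess_norm f + ess_norm g"
      using f g by (intro ess_norm_le ess_bounded_add)
  qed
  have scale_le: "norm (c *\<^sub>R k) \<le> \<bar>c\<bar> * norm k" for c :: real and k :: linf
  proof (transfer, elim conjE)
    fix c :: real and k :: "real^2 \<Rightarrow> real" assume k: "ess_bounded k"
    have "AE x in square_measure. \<bar>c * k x\<bar> \<le> \<bar>c\<bar> * ess_norm k"
      using ess_norm_AE[OF k] by eventually_elim (auto simp: abs_mult intro: mult_left_mono)
    then show "ess_norm (\<lambda>x. c * k x) \<le> \<bar>c\<bar> * ess_norm k"
      using k by (intro ess_norm_le ess_bounded_cmult)
  qed
  show "norm (a *\<^sub>R f) = \<bar>a\<bar> * norm f"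
  proof (cases "a = 0")
    case True
    have "0 \<le> norm (a *\<^sub>R f)"
      by transfer (auto intro: ereal_ess_norm(2) ess_bounded_cmult)
    then show ?thesis
      using True scale_le[of a f] by simp
  next
    case False
    have "inverse a *\<^sub>R a *\<^sub>R f = f"
      using False by transfer (auto simp: mult.assoc[symmetric])
    then have "norm f \<le> \<bar>inverse a\<bar> * norm (a *\<^sub>R f)"
      using scale_le[of "inverse a" "a *\<^sub>R f"] by simp
    then have "\<bar>a\<bar> * norm f \<le> norm (a *\<^sub>R f)"
      using False by (simp add: field_simps)
    then show ?thesis
      using scale_le[of a f] by simp
  qed
qed

end

lift_definition ae_positive :: "linf \<Rightarrow> bool" is "\<lambda>f. AE x in square_measure. 0 < f x"
  by (auto elim: eventually_elim2)

definition linf_pos :: "linf set"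
  where "linf_pos = {\<rho>. ae_positive \<rho>}"

definition bi_lipschitz_with :: "real \<Rightarrow> 'a::metric_space set \<Rightarrow> ('a \<Rightarrow> 'b::metric_space) \<Rightarrow> bool"
  where "bi_lipschitz_with L S f \<longleftrightarrow>
    (\<forall>x\<in>S. \<forall>y\<in>S. 1 / L * dist x y \<le> dist (f x) (f y) \<and> dist (f x) (f y) \<le> L * dist x y)"

definition bi_lipschitz_on :: "'a::metric_space set \<Rightarrow> ('a \<Rightarrow> 'b::metric_space) \<Rightarrow> bool"
  where "bi_lipschitz_on S f \<longleftrightarrow> (\<exists>L\<ge>1. bi_lipschitz_with L S f)"

text \<open>The derivative is taken within the square, so that it depends only on the restriction of the
  map to the square.\<close>

definition Jac :: "(real^2 \<Rightarrow> real^2) \<Rightarrow> real^2 \<Rightarrow> real"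
  where "Jac f x = det (matrix (frechet_derivative f (at x within unit_square)))"

text \<open>The Jacobian of a Lipschitz map is a partial function, so equality with a density at a point
  includes that the Jacobian is defined there. By Rademacher's theorem this holds automatically
  at almost every point.\<close>

lift_definition has_Jac :: "(real^2 \<Rightarrow> real^2) \<Rightarrow> linf \<Rightarrow> bool"
  is "\<lambda>f \<rho>. AE x in square_measure. f differentiable (at x within unit_square) \<and> Jac f x = \<rho> x"
  by (auto elim: eventually_elim2)

definition C_infinity :: "linf set"
  where "C_infinity = {\<rho> \<in> linf_pos. \<not> (\<exists>f. bi_lipschitz_on unit_square f \<and> has_Jac f \<rho>)}"

definition thick_in :: "'a::metric_space set \<Rightarrow> 'a set \<Rightarrow> bool"
  where "thick_in M G \<longleftrightarrow> G \<subseteq> M \<and>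
    (\<exists>U :: nat \<Rightarrow> 'a set.
      (\<forall>n. openin (top_of_set M) (U n) \<and> M \<subseteq> closure (U n)) \<and> (\<Inter>n. U n) \<subseteq> G)"

end

theory Submission
  imports Defs
begin

text \<open>
  This is the argument of Burago and Kleiner, made robust under small perturbations. If \<open>f\<close> is
  \<open>L\<close>-bi-Lipschitz with Jacobian \<open>\<rho>\<close>, then the area of \<open>f ` S\<close> is the integral of \<open>\<rho>\<close> over \<open>S\<close> for
  every rectangle \<open>S\<close>. Suppose that \<open>f\<close> stretches a horizontal segment by a factor \<open>A\<close>, and divide a
  thin strip along it into squares. Either a short horizontal segment in the strip, from a fixed
  finite grid, is stretched by \<open>A + \<kappa>\<close>, or on some square \<open>f\<close> differs from its restriction to the next
  square by almost a translation. By invariance of domain and Brouwer's theorem, the images of these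
  two squares then have almost the same area, which is impossible if the density oscillates along
  the strip. Since \<open>\<kappa>\<close> depends only on \<open>L\<close>, on the bound of \<open>\<rho>\<close> and on the size \<open>h\<close> of the
  oscillation, finitely many rounds of perturbing the density on thin strips enforce a stretch
  factor greater than \<open>L\<close>. So arbitrarily close to every \<open>\<rho>\<close> there is a ball free of Jacobians of
  \<open>L\<close>-bi-Lipschitz maps, and the \<open>G\<^sub>n\<close> are the complements of the closures of the sets of Jacobians
  of \<open>(n + 1)\<close>-bi-Lipschitz maps.
\<close>

subsection \<open>Bi-Lipschitz maps\<close>

lemma bi_lipschitz_withD:
  assumes "bi_lipschitz_with L S f" "L > 0" "x \<in> S" "y \<in> S"
  shows "dist x y \<le> L * dist (f x) (f y)" "dist (f x) (f y) \<le> L * dist x y"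
  using assms by (auto simp: bi_lipschitz_with_def field_simps)

lemma bi_lipschitz_with_mono:
  assumes f: "bi_lipschitz_with L S f" and L: "0 < L" "L \<le> K"
  shows "bi_lipschitz_with K S f"
  unfolding bi_lipschitz_with_def
proof (intro ballI conjI)
  fix x y assume "x \<in> S" "y \<in> S"
  then have *: "1 / L * dist x y \<le> dist (f x) (f y)" "dist (f x) (f y) \<le> L * dist x y"
    using f by (auto simp: bi_lipschitz_with_def)
  have "1 / K * dist x y \<le> 1 / L * dist x y"
    using L by (intro mult_right_mono) (auto simp: frac_le)
  then show "1 / K * dist x y \<le> dist (f x) (f y)"
    using * by simp
  have "L * dist x y \<le> K * dist x y"
    using L by (intro mult_right_mono) auto
  then show "dist (f x) (f y) \<le> K * dist x y"
    using * by simp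
qed

lemma bi_lipschitz_with_subset:
  "bi_lipschitz_with L S f \<Longrightarrow> T \<subseteq> S \<Longrightarrow> bi_lipschitz_with L T f"
  by (auto simp: bi_lipschitz_with_def)

lemma bi_lipschitz_with_inj_on:
  assumes "bi_lipschitz_with L S f" "L > 0"
  shows "inj_on f S"
proof (rule inj_onI)
  fix x y assume "x \<in> S" "y \<in> S" "f x = f y"
  then show "x = y"
    using bi_lipschitz_withD(1)[OF assms, of x y] by simp
qed

lemma bi_lipschitz_with_continuous_on:
  assumes "bi_lipschitz_with L S f" "L > 0"
  shows "continuous_on S f"
proof -
  have "L-lipschitz_on S f"
    using bi_lipschitz_withD(2)[OF assms] assms(2) by (auto simp: lipschitz_on_def)
  then show ?thesis
    by (rule lipschitz_on_continuous_on)
qed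

lemma bi_lipschitz_with_translation:
  fixes f :: "'a::real_normed_vector \<Rightarrow> 'b::real_normed_vector"
  assumes "bi_lipschitz_with L S f" "(\<lambda>x. x + v) ` T \<subseteq> S"
  shows "bi_lipschitz_with L T (\<lambda>x. f (x + v) - u)"
  unfolding bi_lipschitz_with_def
proof (intro ballI)
  fix x y assume "x \<in> T" "y \<in> T"
  then have "x + v \<in> S" "y + v \<in> S" using assms(2) by auto
  then show "1 / L * dist x y \<le> dist (f (x + v) - u) (f (y + v) - u) \<and>
      dist (f (x + v) - u) (f (y + v) - u) \<le> L * dist x y"
    using assms(1) unfolding bi_lipschitz_with_def
    by (metis (no_types, lifting) add_diff_cancel_right dist_norm diff_diff_eq2 diff_add_cancel)
qed

text \<open>By invariance of domain the image of the open ball is open. The lower Lipschitz bound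
  keeps the image of the bounding sphere out of \<open>ball (f x) r\<close>, so inside that ball the
  image is also relatively closed. Connectedness of the ball finishes the argument.\<close>

lemma ball_subset_bi_lipschitz_image:
  fixes f :: "'a::euclidean_space \<Rightarrow> 'a"
  assumes f: "bi_lipschitz_with L (cball x (L * r)) f" and L: "L > 0"
  shows "ball (f x) r \<subseteq> f ` ball x (L * r)"
proof (cases "r > 0")
  case True
  let ?C = "cball x (L * r)" and ?U = "f ` ball x (L * r)"
  have cont: "continuous_on ?C f" and inj: "inj_on f ?C"
    using bi_lipschitz_with_continuous_on[OF f L] bi_lipschitz_with_inj_on[OF f L] by auto
  have opU: "open ?U"
    using True L by (intro invariance_of_domain_ball cont inj) auto
  have "closed (f ` ?C)"
    by (intro compact_imp_closed compact_continuous_image cont) auto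
  moreover have "?U \<inter> ball (f x) r = f ` ?C \<inter> ball (f x) r"
  proof
    show "f ` ?C \<inter> ball (f x) r \<subseteq> ?U \<inter> ball (f x) r"
    proof clarsimp
      fix z assume z: "dist x z \<le> L * r" "dist (f x) (f z) < r"
      have "dist x z \<le> L * dist (f x) (f z)"
        using bi_lipschitz_withD(1)[OF f L, of x z] z True L by auto
      also have "\<dots> < L * r" using z L by simp
      finally show "f z \<in> ?U" by auto
    qed
  qed auto
  ultimately have "closedin (top_of_set (ball (f x) r)) (?U \<inter> ball (f x) r)"
    by (metis closedin_closed_Int inf_commute)
  moreover have "openin (top_of_set (ball (f x) r)) (?U \<inter> ball (f x) r)"
    using opU by (metis openin_open_Int inf_commute)
  moreover have "connected (ball (f x) r)"
    by (simp add: convex_connected)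
  moreover have "f x \<in> ?U \<inter> ball (f x) r"
    using True L by auto
  ultimately show ?thesis
    unfolding connected_clopen by blast
next
  case False
  then have "ball (f x) r = {}" by (simp add: not_less)
  then show ?thesis by blast
qed

text \<open>With \<open>k\<close> the inverse of \<open>f\<close>, solving \<open>h z = f x\<close>
  amounts to finding a fixed point of \<open>y \<mapsto> f x + (y - h (k y))\<close>. This map sends
  \<open>cball (f x) \<delta>\<close> into itself because \<open>y = f (k y)\<close> is within
  \<open>\<delta>\<close> of \<open>h (k y)\<close>, so Brouwer's theorem applies.\<close>

lemma mem_image_of_uniformly_close:
  fixes f h :: "'a::euclidean_space \<Rightarrow> 'a"
  assumes f: "bi_lipschitz_with L (cball x (L * r)) f" and L: "L > 0"
    and h: "continuous_on (cball x (L * r)) h"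
    and close: "\<And>z. z \<in> cball x (L * r) \<Longrightarrow> dist (f z) (h z) \<le> \<delta>" and "0 < \<delta>" "\<delta> < r"
  shows "f x \<in> h ` cball x (L * r)"
proof -
  let ?C = "cball x (L * r)"
  have cont: "continuous_on ?C f" and inj: "inj_on f ?C"
    using bi_lipschitz_with_continuous_on[OF f L] bi_lipschitz_with_inj_on[OF f L] by auto
  \<comment> \<open>Brouwer needs a closed ball, while the preceding lemma covers an open one; the
    gap \<open>\<delta> < r\<close> makes up the difference.\<close>
  have sub: "cball (f x) \<delta> \<subseteq> f ` ?C"
  proof
    fix y assume "y \<in> cball (f x) \<delta>"
    then have "y \<in> ball (f x) r" using \<open>\<delta> < r\<close> by auto
    then have "y \<in> f ` ball x (L * r)"
      using ball_subset_bi_lipschitz_image[OF f L] by blast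
    then show "y \<in> f ` ?C"
      using ball_subset_cball by blast
  qed
  define k where "k = inv_into ?C f"
  have k: "k y \<in> ?C" "f (k y) = y" if "y \<in> cball (f x) \<delta>" for y
    using that sub by (auto simp: k_def inv_into_into f_inv_into_f simp del: mem_cball)
  have "continuous_on (f ` ?C) k"
    unfolding k_def by (rule continuous_on_inv[OF cont]) (use inj in auto)
  then have contk: "continuous_on (cball (f x) \<delta>) k"
    using sub continuous_on_subset by blast
  have "continuous_on (cball (f x) \<delta>) (\<lambda>y. h (k y))"
    by (rule continuous_on_compose2[OF h contk]) (use k in blast)
  then obtain y where y: "y \<in> cball (f x) \<delta>" "f x + (y - h (k y)) = y"
  proof (rule_tac brouwer_ball[of \<delta> "f x" "\<lambda>y. f x + (y - h (k y))"])
    show "(\<lambda>y. f x + (y - h (k y))) \<in> cball (f x) \<delta> \<rightarrow> cball (f x) \<delta>"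
    proof
      fix y assume y: "y \<in> cball (f x) \<delta>"
      then have "dist y (h (k y)) \<le> \<delta>"
        using close[OF k(1)[OF y]] k(2)[OF y] by simp
      then show "f x + (y - h (k y)) \<in> cball (f x) \<delta>"
        by (simp add: dist_norm norm_minus_commute)
    qed
  qed (use \<open>0 < \<delta>\<close> in \<open>auto intro!: continuous_intros\<close>)
  then have "f x = h (k y)" by (simp add: algebra_simps)
  then show ?thesis using k(1)[OF y(1)] by blast
qed

text \<open>The deficits \<open>c - V i k \<bullet> e\<close> are nonnegative and for each
  \<open>k\<close> add up to at most \<open>D\<close>. Hence some \<open>i\<close> has total deficit
  at most \<open>card K * (D / n)\<close>. A vector of norm at most \<open>c\<close> whose component
  along \<open>e\<close> is almost \<open>c\<close> lies close to
  \<open>c *\<^sub>R e\<close>.\<close>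

lemma exists_uniform_index:
  fixes V :: "nat \<Rightarrow> 'k \<Rightarrow> 'a::real_inner"
  assumes K: "finite K" and n: "n > 0" and e: "norm e = 1"
    and V: "\<And>i k. i < n \<Longrightarrow> k \<in> K \<Longrightarrow> norm (V i k) \<le> c"
    and sum: "\<And>k. k \<in> K \<Longrightarrow> real n * c - D \<le> (\<Sum>i<n. V i k \<bullet> e)"
    and c: "c \<ge> 0"
  shows "\<exists>i<n. \<forall>k\<in>K. (norm (V i k - c *\<^sub>R e))\<^sup>2 \<le> 2 * c * (card K * (D / n))"
proof -
  define F where "F i = (\<Sum>k\<in>K. c - V i k \<bullet> e)" for i
  have nonneg: "0 \<le> c - V i k \<bullet> e" if "i < n" "k \<in> K" for i k
    using V[OF that] norm_cauchy_schwarz[of "V i k" e] e by simp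
  have "\<exists>i<n. F i \<le> card K * (D / n)"
  proof (rule ccontr)
    assume "\<not> ?thesis"
    then have "(\<Sum>i<n. card K * (D / n)) < (\<Sum>i<n. F i)"
      using n by (intro sum_strict_mono) (auto simp: not_le)
    also have "(\<Sum>i<n. F i) = (\<Sum>k\<in>K. real n * c - (\<Sum>i<n. V i k \<bullet> e))"
      unfolding F_def by (subst sum.swap) (simp add: sum_subtractf)
    also have "\<dots> \<le> (\<Sum>k\<in>K. D)"
      using sum by (intro sum_mono) (simp add: algebra_simps)
    finally show False using n by simp
  qed
  then obtain i where i: "i < n" "F i \<le> card K * (D / n)" by blast
  have "(norm (V i k - c *\<^sub>R e))\<^sup>2 \<le> 2 * c * (card K * (D / n))" if k: "k \<in> K" for k
  proof -
    have "c - V i k \<bullet> e \<le> F i"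
      unfolding F_def using K k nonneg[OF i(1)]
      by (intro member_le_sum[of k K "\<lambda>k. c - V i k \<bullet> e"]) auto
    then have "2 * c * (c - V i k \<bullet> e) \<le> 2 * c * (card K * (D / n))"
      using i c by (intro mult_left_mono) auto
    moreover have "(norm (V i k - c *\<^sub>R e))\<^sup>2 = (norm (V i k))\<^sup>2 - 2 * c * (V i k \<bullet> e) + c\<^sup>2"
      unfolding power2_norm_eq_inner using e
      by (simp add: inner_diff inner_commute algebra_simps power2_eq_square norm_eq_1)
    moreover have "(norm (V i k))\<^sup>2 \<le> c\<^sup>2"
      using V[OF i(1) k] by (intro power_mono) auto
    ultimately show ?thesis by (simp add: algebra_simps power2_eq_square)
  qed
  with i show ?thesis by blast
qed

section \<open>Coordinates and rectangles in the plane\<close>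

definition plane_point :: "real \<Rightarrow> real \<Rightarrow> real^2"
  where "plane_point a b = vector [a, b]"

lemma plane_point_nth [simp]: "plane_point a b $ 1 = a" "plane_point a b $ 2 = b"
  by (auto simp: plane_point_def)

lemma plane_point_add: "plane_point a b + plane_point c d = plane_point (a + c) (b + d)"
  by (simp add: vec_eq_iff forall_2)

lemma plane_point_eta: "plane_point (x $ 1) (x $ 2) = x"
  by (simp add: vec_eq_iff forall_2)

lemma plane_point_in_square [simp]:
  "plane_point a b \<in> unit_square \<longleftrightarrow> 0 \<le> a \<and> a \<le> 1 \<and> 0 \<le> b \<and> b \<le> 1"
  by (auto simp: unit_square_def forall_2)

lemma cbox_plane_point:
  "x \<in> cbox (plane_point a b) (plane_point c d) \<longleftrightarrow> a \<le> x $ 1 \<and> x $ 1 \<le> c \<and> b \<le> x $ 2 \<and> x $ 2 \<le> d"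
  by (auto simp: mem_box_cart forall_2)

lemma norm_le_sum_abs: "norm (x :: real^2) \<le> \<bar>x $ 1\<bar> + \<bar>x $ 2\<bar>"
  using norm_le_l1_cart[of x] by (simp add: UNIV_2)

lemma dist_plane_point_le: "dist (plane_point a b) (plane_point c d) \<le> \<bar>a - c\<bar> + \<bar>b - d\<bar>"
  using norm_le_sum_abs[of "plane_point a b - plane_point c d"] by (simp add: dist_norm)

lemma content_cbox_plane_point:
  "a \<le> c \<Longrightarrow> b \<le> d \<Longrightarrow> measure lebesgue (cbox (plane_point a b) (plane_point c d)) = (c - a) * (d - b)"
  by (simp add: content_cbox_if_cart UNIV_2 interval_eq_empty_cart) (metis exhaust_2 not_less plane_point_nth)

lemma cbox_plane_point_subset_square:
  "0 \<le> a \<Longrightarrow> c \<le> 1 \<Longrightarrow> 0 \<le> b \<Longrightarrow> d \<le> 1 \<Longrightarrow>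
    cbox (plane_point a b) (plane_point c d) \<subseteq> unit_square"
  by (auto simp: cbox_plane_point unit_square_def forall_2)

subsection \<open>Areas of images of squares\<close>

lemma bounded_measurable_absolutely_integrable_on:
  fixes f :: "'a::euclidean_space \<Rightarrow> real"
  assumes f: "f \<in> borel_measurable lebesgue" and C: "\<And>x. \<bar>f x\<bar> \<le> C" and S: "S \<in> lmeasurable"
  shows "f absolutely_integrable_on S"
proof (rule measurable_bounded_by_integrable_imp_absolutely_integrable)
  show "f \<in> borel_measurable (lebesgue_on S)"
    using f by (rule measurable_restrict_space1)
  show "(\<lambda>x. C) integrable_on S"
    using S by (rule integrable_on_const)
qed (use S C in auto)

lemma abs_integral_le_measure:
  fixes f :: "'a::euclidean_space \<Rightarrow> real"
  assumes f: "f \<in> borel_measurable lebesgue" and C: "\<And>x. \<bar>f x\<bar> \<le> C" and S: "S \<in> lmeasurable"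
  shows "\<bar>integral S f\<bar> \<le> C * measure lebesgue S"
proof -
  have "\<bar>integral S f\<bar> \<le> integral S (\<lambda>x. C)"
    using bounded_measurable_absolutely_integrable_on[OF assms] C S
    unfolding real_norm_def[symmetric]
    by (intro Henstock_Kurzweil_Integration.integral_norm_bound_integral)
      (auto intro: integrable_on_const set_lebesgue_integral_eq_integral(1))
  also have "integral S (\<lambda>x. C) = C * measure lebesgue S"
    using lmeasure_integral[OF S] integral_mult_right[of S C "\<lambda>x. 1::real"] by simp
  finally show ?thesis .
qed

lemma abs_integral_diff_subset_le:
  fixes f :: "'a::euclidean_space \<Rightarrow> real"
  assumes f: "f \<in> borel_measurable lebesgue" and C: "\<And>x. \<bar>f x\<bar> \<le> C"
    and S: "S \<in> lmeasurable" and T: "T \<in> lmeasurable" "T \<subseteq> S"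
  shows "\<bar>integral S f - integral T f\<bar> \<le> C * (measure lebesgue S - measure lebesgue T)"
proof -
  have int: "f integrable_on U" if "U \<in> lmeasurable" for U
    using bounded_measurable_absolutely_integrable_on[OF f C that]
    by (rule set_lebesgue_integral_eq_integral(1))
  have D: "S - T \<in> lmeasurable"
    using S T by (simp add: fmeasurable.Diff)
  have "integral S f = integral (T \<union> (S - T)) f"
    using T by (simp add: Un_absorb1)
  also have "\<dots> = integral T f + integral (S - T) f"
    by (rule Henstock_Kurzweil_Integration.integral_Un) (use int T D in auto)
  finally have "\<bar>integral S f - integral T f\<bar> = \<bar>integral (S - T) f\<bar>" by simp
  also have "\<dots> \<le> C * measure lebesgue (S - T)"
    by (rule abs_integral_le_measure[OF f C D])
  also have "measure lebesgue (S - T) = measure lebesgue S - measure lebesgue T"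
    using measurable_measure_Diff[of S lebesgue T] S T by simp
  finally show ?thesis .
qed

text \<open>The only consequence of having Jacobian \<open>\<rho>\<close> that the argument uses, in a form that is
  stable under small perturbations of \<open>\<rho>\<close>.\<close>

definition nearly_realizes :: "real \<Rightarrow> (real^2 \<Rightarrow> real) \<Rightarrow> real \<Rightarrow> (real^2 \<Rightarrow> real^2) \<Rightarrow> bool"
  where "nearly_realizes L \<rho> \<eta> g \<longleftrightarrow> bi_lipschitz_with L unit_square g \<and>
    (\<forall>a b. cbox a b \<subseteq> unit_square \<longrightarrow>
      \<bar>measure lebesgue (g ` cbox a b) - integral (cbox a b) \<rho>\<bar> \<le> \<eta>)"

lemma translate_cbox_plane_point:
  "(\<lambda>x. x + plane_point s 0) ` cbox (plane_point a b) (plane_point c d) =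
    cbox (plane_point (a + s) b) (plane_point (c + s) d)"
proof -
  have "cbox (plane_point (s + a) (0 + b)) (plane_point (s + c) (0 + d)) =
      (\<lambda>x. plane_point s 0 + x) ` cbox (plane_point a b) (plane_point c d)"
    unfolding plane_point_add[symmetric] by (rule cbox_translation)
  then show ?thesis by (simp add: add.commute)
qed

text \<open>A margin of \<open>2 * L * \<delta>\<close> leaves room around each point of the smaller
  square for the ball that \<open>mem_image_of_uniformly_close\<close> needs with
  \<open>r = 2 * \<delta>\<close>.\<close>

lemma shrunk_square_image_subset:
  fixes f h :: "real^2 \<Rightarrow> real^2"
  assumes f: "bi_lipschitz_with L (cbox (plane_point a b) (plane_point (a + s) (b + s))) f"
    and h: "continuous_on (cbox (plane_point a b) (plane_point (a + s) (b + s))) h"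
    and close: "\<And>x. x \<in> cbox (plane_point a b) (plane_point (a + s) (b + s)) \<Longrightarrow> dist (f x) (h x) \<le> \<delta>"
    and "0 < \<delta>" "0 < L" "m = 2 * L * \<delta>"
  shows "f ` cbox (plane_point (a + m) (b + m)) (plane_point (a + s - m) (b + s - m))
    \<subseteq> h ` cbox (plane_point a b) (plane_point (a + s) (b + s))"
proof clarify
  fix x assume x: "x \<in> cbox (plane_point (a + m) (b + m)) (plane_point (a + s - m) (b + s - m))"
  have sub: "cball x (L * (2 * \<delta>)) \<subseteq> cbox (plane_point a b) (plane_point (a + s) (b + s))"
  proof
    fix z assume "z \<in> cball x (L * (2 * \<delta>))"
    then have "norm (x - z) \<le> m"
      using assms(6) by (simp add: dist_norm mult_ac)
    then have "\<bar>x $ 1 - z $ 1\<bar> \<le> m" "\<bar>x $ 2 - z $ 2\<bar> \<le> m"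
      using component_le_norm_cart[of "x - z" 1] component_le_norm_cart[of "x - z" 2] by auto
    with x show "z \<in> cbox (plane_point a b) (plane_point (a + s) (b + s))"
      by (auto simp: cbox_plane_point)
  qed
  have "f x \<in> h ` cball x (L * (2 * \<delta>))"
  proof (rule mem_image_of_uniformly_close[where f = f and x = x and h = h and L = L and r = "2 * \<delta>" and \<delta> = \<delta>])
    show "bi_lipschitz_with L (cball x (L * (2 * \<delta>))) f"
      using f sub by (rule bi_lipschitz_with_subset)
    show "continuous_on (cball x (L * (2 * \<delta>))) h"
      using h sub by (rule continuous_on_subset)
    show "dist (f z) (h z) \<le> \<delta>" if "z \<in> cball x (L * (2 * \<delta>))" for z
      using that sub close by blast
  qed (use assms in auto)
  then show "f x \<in> h ` cbox (plane_point a b) (plane_point (a + s) (b + s))"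
    using sub by blast
qed

text \<open>The areas of the margins are compared through the approximate Jacobian equation itself, which
  saves estimating the measure of a neighbourhood of the image of the boundary.\<close>

lemma adjacent_squares_integral_close:
  assumes g: "nearly_realizes L \<rho> \<eta> g" and L: "L \<ge> 1"
    and \<rho>: "\<rho> \<in> borel_measurable lebesgue" "\<And>x. \<bar>\<rho> x\<bar> \<le> C"
    and ab: "0 \<le> a" "0 < s" "a + 2 * s \<le> 1" "0 \<le> b" "b + s \<le> 1"
    and close: "\<And>x. x \<in> cbox (plane_point a b) (plane_point (a + s) (b + s)) \<Longrightarrow>
      dist (g x) (g (x + plane_point s 0) - u) \<le> \<delta>"
    and \<delta>: "0 < \<delta>" "4 * L * \<delta> \<le> s"
  shows "\<bar>integral (cbox (plane_point a b) (plane_point (a + s) (b + s))) \<rho>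
    - integral (cbox (plane_point (a + s) b) (plane_point (a + 2 * s) (b + s))) \<rho>\<bar>
    \<le> 8 * C * L * \<delta> * s + 2 * \<eta>"
proof -
  define m where "m = 2 * L * \<delta>"
  define S where "S = cbox (plane_point a b) (plane_point (a + s) (b + s))"
  define S' where "S' = cbox (plane_point (a + m) (b + m)) (plane_point (a + s - m) (b + s - m))"
  define T where "T = cbox (plane_point (a + s) b) (plane_point (a + 2 * s) (b + s))"
  define T' where "T' = cbox (plane_point (a + s + m) (b + m)) (plane_point (a + 2 * s - m) (b + s - m))"
  define v where "v = plane_point s 0"
  \<comment> \<open>The restriction of \<open>g\<close> to the right square, transported to the left
    one. Up to a translation both have the same image.\<close>
  define h where "h x = g (x + v) - u" for x
  have m: "0 < m" "2 * m \<le> s" using L \<delta> by (auto simp: m_def)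
  have L0: "L > 0" using L by simp
  have gl: "bi_lipschitz_with L unit_square g"
    and area: "\<And>a b. cbox a b \<subseteq> unit_square \<Longrightarrow>
      \<bar>measure lebesgue (g ` cbox a b) - integral (cbox a b) \<rho>\<bar> \<le> \<eta>"
    using g by (auto simp: nearly_realizes_def)
  have tr: "(\<lambda>x. x + v) ` S = T" "(\<lambda>x. x + v) ` S' = T'"
    unfolding S_def S'_def T_def T'_def v_def
    unfolding translate_cbox_plane_point by (simp_all add: algebra_simps)
  have sub: "S \<subseteq> unit_square" "T \<subseteq> unit_square" "S' \<subseteq> unit_square" "T' \<subseteq> unit_square"
    unfolding S_def S'_def T_def T'_def
    using ab m by (simp_all add: cbox_plane_point_subset_square)
  have vol: "measure lebesgue S = s * s" "measure lebesgue T = s * s"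
    "measure lebesgue S' = (s - 2 * m) * (s - 2 * m)" "measure lebesgue T' = (s - 2 * m) * (s - 2 * m)"
    using m ab content_cbox_plane_point[of a "a + s" b "b + s"]
      content_cbox_plane_point[of "a + s" "a + 2 * s" b "b + s"]
      content_cbox_plane_point[of "a + m" "a + s - m" "b + m" "b + s - m"]
      content_cbox_plane_point[of "a + s + m" "a + 2 * s - m" "b + m" "b + s - m"]
    unfolding S_def S'_def T_def T'_def by simp_all
  have gS: "bi_lipschitz_with L S g" and hS: "bi_lipschitz_with L S h"
    using bi_lipschitz_with_subset[OF gl sub(1)] bi_lipschitz_with_translation[OF gl, of v S u] tr sub
    by (auto simp: h_def[abs_def])
  have cont: "continuous_on S g" "continuous_on S h"
    using gS hS L0 by (auto intro: bi_lipschitz_with_continuous_on)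
  have S'S: "S' \<subseteq> S" and T'T: "T' \<subseteq> T"
    using m by (auto simp: S_def S'_def T_def T'_def cbox_plane_point)
  have close': "dist (g x) (h x) \<le> \<delta>" "dist (h x) (g x) \<le> \<delta>" if "x \<in> S" for x
    using close[of x] that by (auto simp: S_def h_def v_def dist_commute)
  have 1: "g ` S' \<subseteq> h ` S"
    unfolding S_def S'_def
    by (rule shrunk_square_image_subset[where L=L and \<delta>=\<delta>])
      (use gS cont close' \<delta> L0 m_def in \<open>auto simp: S_def\<close>)
  have 2: "h ` S' \<subseteq> g ` S"
    unfolding S_def S'_def
    by (rule shrunk_square_image_subset[where L=L and \<delta>=\<delta>])
      (use hS cont close' \<delta> L0 m_def in \<open>auto simp: S_def\<close>)
  have hT: "measure lebesgue (h ` S) = measure lebesgue (g ` T)"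
    "measure lebesgue (h ` S') = measure lebesgue (g ` T')"
    using measure_translation_subtract[of u "g ` T"] measure_translation_subtract[of u "g ` T'"]
    by (auto simp: tr[symmetric] h_def image_image)
  have lm: "g ` S \<in> lmeasurable" "h ` S \<in> lmeasurable" "g ` S' \<in> lmeasurable" "h ` S' \<in> lmeasurable"
    using cont S'S
    by (auto intro!: lmeasurable_compact compact_continuous_image intro: continuous_on_subset
        simp: S_def S'_def)
  \<comment> \<open>The area of \<open>g\<close> S'\<open>is at most that of\<close>g
    \<open>T\<close>, and symmetrically for \<open>T'\<close> and \<open>S\<close>. Passing from
    areas to integrals costs \<open>\<eta>\<close> twice, and restoring the margin costs at most
    \<open>C * (4 * m * s)\<close>.\<close>
  have "measure lebesgue (g ` S') \<le> measure lebesgue (g ` T)"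
    using measure_mono_fmeasurable[OF 1 fmeasurableD[OF lm(3)] lm(2)] hT by simp
  moreover have "measure lebesgue (g ` T') \<le> measure lebesgue (g ` S)"
    using measure_mono_fmeasurable[OF 2 fmeasurableD[OF lm(4)] lm(1)] hT by simp
  moreover have "\<bar>measure lebesgue (g ` S') - integral S' \<rho>\<bar> \<le> \<eta>"
    "\<bar>measure lebesgue (g ` T') - integral T' \<rho>\<bar> \<le> \<eta>"
    "\<bar>measure lebesgue (g ` S) - integral S \<rho>\<bar> \<le> \<eta>"
    "\<bar>measure lebesgue (g ` T) - integral T \<rho>\<bar> \<le> \<eta>"
    using area sub unfolding S_def S'_def T_def T'_def by auto
  moreover have "measure lebesgue S - measure lebesgue S' \<le> 4 * m * s"
    "measure lebesgue T - measure lebesgue T' \<le> 4 * m * s"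
    unfolding vol by (simp_all add: algebra_simps)
  moreover have "C \<ge> 0" using \<rho>(2)[of 0] by linarith
  moreover have "\<bar>integral S \<rho> - integral S' \<rho>\<bar> \<le> C * (measure lebesgue S - measure lebesgue S')"
    "\<bar>integral T \<rho> - integral T' \<rho>\<bar> \<le> C * (measure lebesgue T - measure lebesgue T')"
    by (rule abs_integral_diff_subset_le[OF \<rho> _ _ S'S] abs_integral_diff_subset_le[OF \<rho> _ _ T'T];
        simp add: S_def S'_def T_def T'_def)+
  ultimately have "\<bar>integral S \<rho> - integral T \<rho>\<bar> \<le> C * (4 * m * s) + 2 * \<eta>"
    using mult_left_mono[of "measure lebesgue S - measure lebesgue S'" "4 * m * s" C]
      mult_left_mono[of "measure lebesgue T - measure lebesgue T'" "4 * m * s" C]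
    by linarith
  then show ?thesis
    by (simp add: S_def T_def m_def mult_ac)
qed

subsection \<open>Stretched segments\<close>

lemma grid_point_below:
  assumes "0 < d" "0 \<le> y" "y \<le> real M * d"
  shows "\<exists>r\<le>M. \<bar>y - real r * d\<bar> \<le> d"
proof -
  define r where "r = nat \<lfloor>y / d\<rfloor>"
  have "real r \<le> y / d" "y / d < real r + 1"
    using assms by (auto simp: r_def)
  then have r: "real r * d \<le> y" "y < real r * d + d"
    using assms by (auto simp: field_simps)
  then have "real r * d \<le> real M * d" using assms by linarith
  then have "r \<le> M" using assms by simp
  moreover have "\<bar>y - real r * d\<bar> \<le> d" using r by linarith
  ultimately show ?thesis by blast
qed

text \<open>Averaging: along each row of the grid the steps of length \<open>s\<close> add up to nearly the largest
  displacement that the bound on the single steps permits. Hence there is one index at which all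
  steps, in all rows and for all offsets, nearly equal the same extremal vector.\<close>

lemma exists_almost_translated_square:
  fixes N M :: nat and g :: "real^2 \<Rightarrow> real^2" and L l s d a b A \<kappa> \<sigma> :: real
  assumes g: "bi_lipschitz_with L unit_square g" and L: "L \<ge> 1"
    and N: "N \<ge> 2" and M: "M \<ge> 1" and l: "0 < l" and s: "s = l / N" and d: "d = s / M"
    and ab: "0 \<le> a" "a + l \<le> 1" "0 \<le> b" "b + s \<le> 1" and A: "0 \<le> A" "0 < \<kappa>"
    and stretched: "A * l \<le> dist (g (plane_point a b)) (g (plane_point (a + l) b))"
    and unstretched: "\<And>m q. m \<le> (N - 1) * M \<Longrightarrow> q \<le> M \<Longrightarrow>
      dist (g (plane_point (a + m * d) (b + q * d))) (g (plane_point (a + m * d + s) (b + q * d)))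
        \<le> (A + \<kappa>) * s"
    and \<sigma>: "0 \<le> \<sigma>" "4 * L \<le> \<sigma> * M" "2 * (A + \<kappa>) * ((M + 1)\<^sup>2 * (2 * \<kappa> + 8 * L / N)) \<le> \<sigma>\<^sup>2"
  shows "\<exists>i<N - 1. \<exists>u. \<forall>x\<in>cbox (plane_point (a + i * s) b) (plane_point (a + i * s + s) (b + s)).
    dist (g x) (g (x + plane_point s 0) - u) \<le> 2 * \<sigma> * s"
proof -
  \<comment> \<open>One step fewer than the number of squares: a row may start up to
    \<open>s\<close> to the right of \<open>a\<close>, and each square needs a right neighbour in
    the strip.\<close>
  define n where "n = N - 1"
  have n: "n > 0" "real N = real n + 1" using N by (auto simp: n_def)
  have s0: "s > 0" and d0: "d > 0" and sN: "real N * s = l" and dM: "real M * d = s"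
    using s d l N M by auto
  have L0: "L > 0" using L by simp
  define w where "w = g (plane_point (a + l) b) - g (plane_point a b)"
  define e where "e = w /\<^sub>R norm w"
  define c where "c = (A + \<kappa>) * s"
  \<comment> \<open>The shortfall allowed in one row: \<open>N * \<kappa> * s\<close> is the slack
    between \<open>A\<close> and \<open>A + \<kappa>\<close>, and \<open>4 * L * s\<close> arises
    because both ends of the row are within \<open>2 * s\<close> of the ends of the segment.\<close>
  define D where "D = (N * \<kappa> + 4 * L) * s"
  define G where "G m q = g (plane_point (a + real m * d) (b + real q * d))" for m q
  \<comment> \<open>A step of length \<open>s\<close> is \<open>M\<close> grid spacings. The pair
    \<open>k\<close> consists of the horizontal offset and the row.\<close>
  define V where "V i k = G (fst k + (i + 1) * M) (snd k) - G (fst k + i * M) (snd k)" for i k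
  have lip: "dist (g x) (g y) \<le> L * dist x y" if "x \<in> unit_square" "y \<in> unit_square" for x y
    using bi_lipschitz_withD(2)[OF g L0 that] .
  have lip': "norm (g x - g y) \<le> L * k"
    if "x \<in> unit_square" "y \<in> unit_square" "dist x y \<le> k" for x y k
    using lip[OF that(1,2)] mult_left_mono[OF that(3) less_imp_le[OF L0]]
    unfolding dist_norm[of "g x"] by linarith
  have l1: "l = dist (plane_point (a + l) b) (plane_point a b)"
    using l by (simp add: dist_norm norm_vec_def L2_set_def UNIV_2)
  have "s * 1 \<le> s * real N" using s0 N by (intro mult_left_mono) auto
  then have "s \<le> l" using sN by (simp add: mult.commute)
  have "l \<le> L * norm w"
    using bi_lipschitz_withD(1)[OF g L0, of "plane_point (a + l) b" "plane_point a b"] ab l s0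
    by (simp add: w_def dist_norm[symmetric] l1[symmetric])
  then have w0: "w \<noteq> 0" using l by auto
  have e: "norm e = 1" "w \<bullet> e = norm w"
    using w0 by (auto simp: e_def dot_square_norm power2_eq_square)
  have c0: "c \<ge> 0" using A s0 by (simp add: c_def)
  have small: "real m * d \<le> s" if "m \<le> M" for m
    using that d0 dM mult_right_mono[of "real m" "real M" d] by simp
  have "\<exists>i<n. \<forall>k\<in>{..M} \<times> {..M}. (norm (V i k - c *\<^sub>R e))\<^sup>2 \<le> 2 * c * (card ({..M} \<times> {..M}) * (D / n))"
  proof (rule exists_uniform_index[OF _ n(1) e(1) _ _ c0])
    fix i k assume i: "i < n" and k: "k \<in> {..M} \<times> {..M}"
    have eq: "a + real (fst k + (i + 1) * M) * d = a + real (fst k + i * M) * d + s"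
      using dM by (simp add: algebra_simps)
    have "i + 1 \<le> N - 1" using i by (simp add: n_def)
    then have "(i + 1) * M \<le> (N - 1) * M" by (rule mult_le_mono1)
    then have "fst k + i * M \<le> (N - 1) * M" using k by (cases k) simp
    then show "norm (V i k) \<le> c"
      using unstretched[of "fst k + i * M" "snd k"] k unfolding V_def G_def eq c_def
      by (cases k) (simp add: dist_norm norm_minus_commute)
  next
    fix k assume k: "k \<in> {..M} \<times> {..M}"
    obtain r q where rq: "k = (r, q)" "r \<le> M" "q \<le> M" using k by auto
    define y where "y = plane_point (a + real r * d) (b + real q * d)"
    define z where "z = plane_point (a + real (r + n * M) * d) (b + real q * d)"
    have nM: "real (r + n * M) * d = real r * d + (l - s)"
    proof -
      have "real (r + n * M) * d = real r * d + real n * (real M * d)"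
        by (simp add: algebra_simps)
      also have "real n * (real M * d) = l - s"
        unfolding dM using sN n by (simp add: algebra_simps)
      finally show ?thesis .
    qed
    have rs: "0 \<le> real r * d" "real r * d \<le> s" "0 \<le> real q * d" "real q * d \<le> s"
      using small rq d0 by auto
    have in_sq: "y \<in> unit_square" "z \<in> unit_square" "plane_point a b \<in> unit_square"
        "plane_point (a + l) b \<in> unit_square"
      using rs ab \<open>s \<le> l\<close> l s0 nM unfolding y_def z_def plane_point_in_square by linarith+
    have "dist y (plane_point a b) \<le> 2 * s"
      unfolding y_def by (rule order_trans[OF dist_plane_point_le]) (use rs in auto)
    then have 1: "norm (g y - g (plane_point a b)) \<le> L * (2 * s)"
      by (rule lip'[OF in_sq(1) in_sq(3)])
    have "dist z (plane_point (a + l) b) \<le> 2 * s"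
      unfolding z_def nM by (rule order_trans[OF dist_plane_point_le]) (use rs in auto)
    then have 2: "norm (g z - g (plane_point (a + l) b)) \<le> L * (2 * s)"
      by (rule lip'[OF in_sq(2) in_sq(4)])
    have 3: "(g y - g (plane_point a b)) \<bullet> e \<le> L * (2 * s)"
      using 1 norm_cauchy_schwarz[of "g y - g (plane_point a b)" e] unfolding e(1) by linarith
    have 4: "- (L * (2 * s)) \<le> (g z - g (plane_point (a + l) b)) \<bullet> e"
      using 2 Cauchy_Schwarz_ineq2[of "g z - g (plane_point (a + l) b)" e] unfolding e(1) by linarith
    have "(\<Sum>i<n. V i k \<bullet> e) = (\<Sum>i<n. G (r + Suc i * M) q \<bullet> e - G (r + i * M) q \<bullet> e)"
      by (simp add: V_def rq inner_diff_left)
    also have "\<dots> = G (r + n * M) q \<bullet> e - G (r + 0 * M) q \<bullet> e"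
      by (rule sum_lessThan_telescope)
    also have "\<dots> = (g z - g (plane_point (a + l) b)) \<bullet> e + w \<bullet> e - (g y - g (plane_point a b)) \<bullet> e"
      by (simp add: G_def y_def z_def w_def inner_diff_left)
    also have "\<dots> \<ge> - (L * (2 * s)) + norm w - L * (2 * s)"
      using 3 4 unfolding e(2) by linarith
    finally have 5: "norm w - 4 * L * s \<le> (\<Sum>i<n. V i k \<bullet> e)" by (simp add: algebra_simps)
    have "real n * c \<le> real N * c" using n c0 by (intro mult_right_mono) auto
    also have "real N * c = A * l + real N * \<kappa> * s"
      using sN by (simp add: c_def algebra_simps)
    also have "\<dots> \<le> norm w + real N * \<kappa> * s"
      using stretched by (simp add: w_def dist_norm norm_minus_commute)
    finally show "real n * c - D \<le> (\<Sum>i<n. V i k \<bullet> e)"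
      using 5 by (simp add: D_def algebra_simps)
  qed auto
  then obtain i where i: "i < n"
    and Vi: "\<And>r q. r \<le> M \<Longrightarrow> q \<le> M \<Longrightarrow> (norm (V i (r, q) - c *\<^sub>R e))\<^sup>2 \<le> 2 * c * ((M + 1)\<^sup>2 * (D / n))"
    by (auto simp: power2_eq_square)
  \<comment> \<open>Since \<open>N \<ge> 2\<close>, we have \<open>N \<le> 2 * n\<close>, which
    removes \<open>n\<close> from the bound.\<close>
  have "D / n \<le> (2 * \<kappa> + 8 * L / N) * s"
  proof -
    have N2: "real N \<le> 2 * real n" "real n > 0" "real N > 0" using n by auto
    have "D / n = s * (\<kappa> * (real N / n) + 4 * L * (1 / n))"
      by (simp add: D_def field_simps add_divide_distrib)
    also have "\<dots> \<le> s * (\<kappa> * 2 + 4 * L * (2 / N))"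
      using N2 s0 A L0 by (intro mult_left_mono add_mono) (auto simp: field_simps)
    finally show ?thesis by (simp add: algebra_simps)
  qed
  then have "2 * c * ((M + 1)\<^sup>2 * (D / n)) \<le> 2 * c * ((M + 1)\<^sup>2 * ((2 * \<kappa> + 8 * L / N) * s))"
    using c0 by (intro mult_left_mono) auto
  also have "\<dots> = (2 * (A + \<kappa>) * ((M + 1)\<^sup>2 * (2 * \<kappa> + 8 * L / N))) * s\<^sup>2"
    by (simp add: c_def power2_eq_square mult_ac)
  also have "\<dots> \<le> \<sigma>\<^sup>2 * s\<^sup>2"
    using \<sigma>(3) by (rule mult_right_mono) auto
  finally have bound: "2 * c * ((M + 1)\<^sup>2 * (D / n)) \<le> \<sigma>\<^sup>2 * s\<^sup>2" .
  have Vi': "norm (V i (r, q) - c *\<^sub>R e) \<le> \<sigma> * s" if "r \<le> M" "q \<le> M" for r q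
  proof (rule power2_le_imp_le)
    show "(norm (V i (r, q) - c *\<^sub>R e))\<^sup>2 \<le> (\<sigma> * s)\<^sup>2"
      unfolding power_mult_distrib by (rule order_trans[OF Vi[OF that] bound])
  qed (use \<sigma>(1) s0 in simp)
  \<comment> \<open>From the grid to arbitrary points: \<open>x\<close> is within
    \<open>2 * d\<close> of a grid point, so rounding \<open>x\<close> and its translate costs
    \<open>4 * L * d\<close> in all. The choice of \<open>M\<close> makes this at most
    \<open>\<sigma> * s\<close>.\<close>
  have "dist (g x) (g (x + plane_point s 0) - c *\<^sub>R e) \<le> 2 * \<sigma> * s"
    if x: "x \<in> cbox (plane_point (a + i * s) b) (plane_point (a + i * s + s) (b + s))" for x
  proof -
    obtain r where r: "r \<le> M" "\<bar>x $ 1 - (a + i * s) - real r * d\<bar> \<le> d"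
      using grid_point_below[OF d0, of "x $ 1 - (a + i * s)" M] x dM by (auto simp: cbox_plane_point)
    obtain q where q: "q \<le> M" "\<bar>x $ 2 - b - real q * d\<bar> \<le> d"
      using grid_point_below[OF d0, of "x $ 2 - b" M] x dM by (auto simp: cbox_plane_point)
    define z where "z = plane_point (a + real (r + i * M) * d) (b + real q * d)"
    define v where "v = plane_point s 0"
    have iM: "real (r + i * M) * d = real r * d + real i * s"
      using dM by (simp add: algebra_simps)
    have z': "z + v = plane_point (a + real (r + (i + 1) * M) * d) (b + real q * d)"
      using dM by (simp add: z_def v_def plane_point_add algebra_simps)
    have V: "V i (r, q) = g (z + v) - g z"
      unfolding V_def G_def fst_conv snd_conv z' by (simp only: z_def)
    have "dist x z \<le> \<bar>x $ 1 - (a + real (r + i * M) * d)\<bar> + \<bar>x $ 2 - (b + real q * d)\<bar>"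
      using dist_plane_point_le[of "x $ 1" "x $ 2"] by (simp add: plane_point_eta z_def)
    then have xz: "dist x z \<le> 2 * d" using r q unfolding iM by linarith
    have i_s: "0 \<le> real i * s" "real i * s + 2 * s \<le> l"
    proof -
      have "(real i + 2) * s \<le> real N * s"
        using i s0 n by (intro mult_right_mono) auto
      then show "real i * s + 2 * s \<le> l" using sN by (simp add: algebra_simps)
    qed (use s0 in auto)
    have rs: "0 \<le> real r * d" "real r * d \<le> s" "0 \<le> real q * d" "real q * d \<le> s"
      using small r q d0 by auto
    have sq: "z \<in> unit_square" "z + v \<in> unit_square"
      using rs i_s ab s0 unfolding z_def v_def plane_point_add plane_point_in_square iM by linarith+
    have "plane_point (x $ 1) (x $ 2) \<in> unit_square" "plane_point (x $ 1) (x $ 2) + v \<in> unit_square"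
      using x i_s ab s0 unfolding v_def plane_point_add plane_point_in_square cbox_plane_point by linarith+
    then have xsq: "x \<in> unit_square" "x + v \<in> unit_square" by (simp_all add: plane_point_eta)
    have "norm (g x - g z) \<le> L * (2 * d)"
      by (rule lip'[OF xsq(1) sq(1) xz])
    moreover have "norm (g (x + v) - g (z + v)) \<le> L * (2 * d)"
      by (rule lip'[OF xsq(2) sq(2)]) (use xz in \<open>simp add: dist_norm\<close>)
    moreover have "norm (g (z + v) - g z - c *\<^sub>R e) \<le> \<sigma> * s"
      using Vi'[OF r(1) q(1)] by (simp add: V)
    ultimately have "norm ((g x - g z) - (g (x + v) - g (z + v)) - (g (z + v) - g z - c *\<^sub>R e))
        \<le> L * (2 * d) + L * (2 * d) + \<sigma> * s"
      by (rule order_trans[OF norm_triangle_ineq4 add_mono[OF order_trans[OF norm_triangle_ineq4 add_mono]]])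
    then have "norm (g x - (g (x + v) - c *\<^sub>R e)) \<le> L * (2 * d) + L * (2 * d) + \<sigma> * s"
      by (simp add: algebra_simps)
    moreover have "4 * L * d \<le> \<sigma> * s"
      using mult_right_mono[OF \<sigma>(2), of d] d0 dM by (simp add: mult.assoc)
    ultimately show ?thesis by (simp add: dist_norm v_def algebra_simps)
  qed
  then show ?thesis using i unfolding n_def by blast
qed

subsection \<open>Perturbing the density on a strip\<close>

text \<open>The function modified here is the correction to the density, not the density. On the
  strip the old correction is replaced instead of increased, so corrections stay within
  \<open>{0..h}\<close> however many rounds are made and however strips overlap.\<close>

definition overwrite_strip ::
    "(nat \<Rightarrow> real) \<Rightarrow> real \<Rightarrow> real \<Rightarrow> real \<Rightarrow> real \<Rightarrow> (real^2 \<Rightarrow> real) \<Rightarrow> real^2 \<Rightarrow> real"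
  where "overwrite_strip t a b l s u x =
    (if x \<in> cbox (plane_point a b) (plane_point (a + l) (b + s)) then t (nat \<lfloor>(x $ 1 - a) / s\<rfloor>) else u x)"

lemma overwrite_strip_measurable:
  assumes "u \<in> borel_measurable lebesgue"
  shows "overwrite_strip t a b l s u \<in> borel_measurable lebesgue"
proof -
  have "(\<lambda>x::real^2. (x $ 1 - a) / s) \<in> borel_measurable borel"
    unfolding divide_inverse by (intro borel_measurable_continuous_onI continuous_intros)
  then have "(\<lambda>x::real^2. t (nat \<lfloor>(x $ 1 - a) / s\<rfloor>)) \<in> borel_measurable borel"
    by measurable
  then have "(\<lambda>x::real^2. t (nat \<lfloor>(x $ 1 - a) / s\<rfloor>)) \<in> borel_measurable lebesgue"
    by (simp add: measurable_completion)
  then show ?thesis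
    unfolding overwrite_strip_def[abs_def] using assms
    by (intro measurable_If_set) auto
qed

lemma integral_overwrite_strip:
  assumes s: "0 < s" "real N * s = l" "i < N"
    and \<rho>: "\<rho> integrable_on cbox (plane_point (a + i * s) b) (plane_point (a + i * s + s) (b + s))"
  shows "integral (cbox (plane_point (a + i * s) b) (plane_point (a + i * s + s) (b + s)))
      (\<lambda>x. \<rho> x + overwrite_strip t a b l s u x) =
    integral (cbox (plane_point (a + i * s) b) (plane_point (a + i * s + s) (b + s))) \<rho> + t i * (s * s)"
    (is "integral ?S _ = _")
proof -
  have "integral ?S (\<lambda>x. \<rho> x + overwrite_strip t a b l s u x) = integral ?S (\<lambda>x. \<rho> x + t i)"
  proof (rule integral_spike)
    \<comment> \<open>On the right edge of the square the floor is already
      \<open>i + 1\<close>.\<close>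
    show "negligible {x :: real^2. x $ 1 = a + i * s + s}"
      using negligible_standard_hyperplane[of "axis 1 1 :: real^2" "a + i * s + s"]
      by (simp add: inner_axis axis_in_Basis_iff)
    fix x assume x: "x \<in> ?S - {x. x $ 1 = a + i * s + s}"
    then have "\<lfloor>(x $ 1 - a) / s\<rfloor> = int i"
      using s by (auto simp: cbox_plane_point floor_eq_iff field_simps)
    moreover have "real i * s + s \<le> l"
    proof -
      have "(real i + 1) * s \<le> real N * s" using s by (intro mult_right_mono) auto
      then show ?thesis using s by (simp add: algebra_simps)
    qed
    moreover have "a \<le> a + real i * s" using s by simp
    ultimately have "overwrite_strip t a b l s u x = t i"
      using x unfolding overwrite_strip_def cbox_plane_point Diff_iff
      by (subst if_P) (linarith, simp)
    then show "\<rho> x + t i = \<rho> x + overwrite_strip t a b l s u x" by simp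
  qed
  also have "\<dots> = integral ?S \<rho> + integral ?S (\<lambda>x. t i)"
    using \<rho> by (intro Henstock_Kurzweil_Integration.integral_add) auto
  also have "integral ?S (\<lambda>x. t i) = t i * (s * s)"
    using s content_cbox_plane_point[of "a + i * s" "a + i * s + s" b "b + s"] by simp
  finally show ?thesis .
qed

text \<open>The choice is greedy: whatever \<open>t i\<close> is, the two candidates for \<open>t (Suc i)\<close> differ by \<open>h\<close>. So
  nothing needs to be known about the unperturbed density.\<close>

lemma exists_oscillating_correction:
  fixes I :: "nat \<Rightarrow> real"
  assumes "0 < h"
  obtains t where "\<And>i. t i \<in> {0, h}" "\<And>i. h / 2 \<le> \<bar>(I i + t i) - (I (Suc i) + t (Suc i))\<bar>"
proof -
  define t where "t = rec_nat 0 (\<lambda>i ti. if h / 2 \<le> \<bar>(I i + ti) - I (Suc i)\<bar> then 0 else h)"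
  have t: "t 0 = 0" "\<And>i. t (Suc i) = (if h / 2 \<le> \<bar>(I i + t i) - I (Suc i)\<bar> then 0 else h)"
    by (auto simp: t_def)
  have "t i \<in> {0, h}" for i
    by (cases i) (auto simp: t)
  moreover have "h / 2 \<le> \<bar>(I i + t i) - (I (Suc i) + t (Suc i))\<bar>" for i
  proof (cases "h / 2 \<le> \<bar>(I i + t i) - I (Suc i)\<bar>")
    case True
    then show ?thesis by (simp add: t(2))
  next
    case False
    then have "t (Suc i) = h" by (simp add: t(2))
    then show ?thesis using False assms by linarith
  qed
  ultimately show ?thesis by (rule that)
qed

lemma nearly_realizes_mono:
  assumes g: "nearly_realizes L \<rho>' \<eta>' g"
    and diff: "\<And>a b. cbox a b \<subseteq> unit_square \<Longrightarrow>
      \<bar>integral (cbox a b) \<rho>' - integral (cbox a b) \<rho>\<bar> \<le> \<eta> - \<eta>'"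
  shows "nearly_realizes L \<rho> \<eta> g"
  unfolding nearly_realizes_def
proof (intro conjI allI impI)
  show "bi_lipschitz_with L unit_square g" using g by (simp add: nearly_realizes_def)
  fix a b :: "real^2" assume ab: "cbox a b \<subseteq> unit_square"
  then have "\<bar>measure lebesgue (g ` cbox a b) - integral (cbox a b) \<rho>'\<bar> \<le> \<eta>'"
    using g by (simp add: nearly_realizes_def)
  then show "\<bar>measure lebesgue (g ` cbox a b) - integral (cbox a b) \<rho>\<bar> \<le> \<eta>"
    using diff[OF ab] by linarith
qed

text \<open>A triple \<open>(a, b, l)\<close> stands for the segment from \<open>(a, b)\<close> to \<open>(a + l, b)\<close>. The top edge is
  excluded so that there is room for a strip above the segment.\<close>

definition horizontal_segments :: "(real \<times> real \<times> real) set"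
  where "horizontal_segments = {(a, b, l). 0 \<le> a \<and> 0 < l \<and> a + l \<le> 1 \<and> 0 \<le> b \<and> b < 1}"

definition stretches :: "(real^2 \<Rightarrow> real^2) \<Rightarrow> real \<Rightarrow> real \<times> real \<times> real \<Rightarrow> bool"
  where "stretches g A = (\<lambda>(a, b, l). A * l \<le> dist (g (plane_point a b)) (g (plane_point (a + l) b)))"

text \<open>Finitely many rounds suffice because the gain \<open>\<kappa>\<close> depends on nothing that changes from round
  to round.\<close>

lemma increase_stretch_of_segment:
  fixes \<rho>0 :: "real^2 \<Rightarrow> real"
  assumes \<rho>0: "\<rho>0 \<in> borel_measurable lebesgue" "\<And>x. \<bar>\<rho>0 x\<bar> \<le> B" and L: "L \<ge> 1" and h: "0 < h"
  obtains \<kappa> where "0 < \<kappa>" and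
    "\<And>u \<eta> a b l A. \<lbrakk>u \<in> borel_measurable lebesgue; \<And>x. u x \<in> {0..h}; 0 < \<eta>;
        (a, b, l) \<in> horizontal_segments; 0 \<le> A; A \<le> L\<rbrakk> \<Longrightarrow>
      \<exists>u' \<eta>' T. u' \<in> borel_measurable lebesgue \<and> (\<forall>x. u' x \<in> {0..h}) \<and> 0 < \<eta>' \<and>
        finite T \<and> T \<subseteq> horizontal_segments \<and>
        (\<forall>g. nearly_realizes L (\<lambda>x. \<rho>0 x + u' x) \<eta>' g \<longrightarrow>
          nearly_realizes L (\<lambda>x. \<rho>0 x + u x) \<eta> g \<and>
          (stretches g A (a, b, l) \<longrightarrow> (\<exists>p\<in>T. stretches g (A + \<kappa>) p)))"
proof -
  \<comment> \<open>A bound for all densities \<open>\<rho>0 + u\<close> with \<open>u\<close> in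
    \<open>{0..h}\<close>.\<close>
  define C where "C = B + h"
  have "0 \<le> B" using \<rho>0(2)[of 0] by linarith
  then have C: "0 < C" "h \<le> C" using h by (auto simp: C_def)
  have L0: "0 < L" using L by simp
  \<comment> \<open>Chosen so that the margin term of
    \<open>adjacent_squares_integral_close\<close>, with \<open>2 * \<sigma> * s\<close> for
    \<open>\<delta>\<close>, becomes \<open>h / 4 * (s * s)\<close>, half of the enforced
    oscillation.\<close>
  define \<sigma> where "\<sigma> = h / (64 * C * L)"
  have "h * 1 \<le> C * L" using C L h by (intro mult_mono) auto
  then have \<sigma>: "0 < \<sigma>" "\<sigma> \<le> 1 / 64" "64 * C * L * \<sigma> = h"
    using C L h by (auto simp: \<sigma>_def field_simps)
  have \<sigma>L: "8 * L * \<sigma> \<le> 1"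
    using C L h by (auto simp: \<sigma>_def field_simps)
  obtain M :: nat where M: "4 * L / \<sigma> + 1 \<le> M" using real_arch_simple by blast
  have "0 \<le> 4 * L / \<sigma>" using \<sigma> L0 by simp
  with M have M1: "M \<ge> 1" by linarith
  have M\<sigma>: "4 * L \<le> \<sigma> * M" using M \<sigma> by (simp add: field_simps)
  define K where "K = (real M + 1)\<^sup>2"
  have K: "K > 0" "K \<ge> 1" by (auto simp: K_def)
  \<comment> \<open>As \<open>A + \<kappa> \<le> 2 * L\<close>, the \<open>\<kappa>\<close> term in
    the smallness condition of \<open>exists_almost_translated_square\<close> uses up at most half
    of \<open>\<sigma>\<^sup>2\<close>. The other half is left for the term with
    \<open>N\<close>.\<close>
  define \<kappa> where "\<kappa> = \<sigma>\<^sup>2 / (16 * L * K)"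
  have \<kappa>: "0 < \<kappa>" using \<sigma> L K by (simp add: \<kappa>_def)
  have \<kappa>K: "16 * L * (K * \<kappa>) = \<sigma>\<^sup>2" using K L by (simp add: \<kappa>_def)
  have "\<kappa> \<le> L"
  proof -
    have "\<sigma>\<^sup>2 \<le> 1" using \<sigma> by (intro power_le_one) auto
    moreover have "1 * 1 \<le> L * K" using L K by (intro mult_mono) auto
    ultimately have "\<kappa> \<le> 1" using L K by (auto simp: \<kappa>_def divide_le_eq)
    then show ?thesis using L by simp
  qed
  show ?thesis
  proof (rule that[OF \<kappa>])
    fix u :: "real^2 \<Rightarrow> real" and \<eta> a b l A :: real
    assume u: "u \<in> borel_measurable lebesgue" "\<And>x. u x \<in> {0..h}" and \<eta>: "0 < \<eta>"
      and seg: "(a, b, l) \<in> horizontal_segments" and A: "0 \<le> A" "A \<le> L"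
    have ab: "0 \<le> a" "0 < l" "a + l \<le> 1" "0 \<le> b" "b < 1"
      using seg by (auto simp: horizontal_segments_def)
    \<comment> \<open>The summands ensure in turn \<open>N \<ge> 2\<close>, the remaining half of
      the smallness condition, that the strip stays below the top edge, and that it is thin enough
      to change integrals by at most \<open>\<eta> / 2\<close>.\<close>
    obtain N :: nat where N: "2 + 64 * L\<^sup>2 * K / \<sigma>\<^sup>2 + l / (1 - b) + 2 * h * l\<^sup>2 / \<eta> + 1 \<le> N"
      using real_arch_simple by blast
    have nonneg: "0 \<le> 64 * L\<^sup>2 * K / \<sigma>\<^sup>2" "0 \<le> l / (1 - b)" "0 \<le> 2 * h * l\<^sup>2 / \<eta>"
      using K ab h \<eta> by auto
    have N2: "2 \<le> N" using N nonneg by linarith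
    have N_pos: "0 < real N" using N2 by simp
    have NK: "64 * L\<^sup>2 * K / \<sigma>\<^sup>2 \<le> N" and Nb: "l / (1 - b) \<le> N" "l / (1 - b) < N"
      and N\<eta>: "2 * h * l\<^sup>2 / \<eta> \<le> N"
      using N nonneg by linarith+
    define s where "s = l / N"
    define d where "d = s / M"
    have s0: "0 < s" and sN: "real N * s = l" using ab N_pos by (auto simp: s_def)
    have d0: "0 < d" and dM: "real M * d = s" using s0 M1 by (auto simp: d_def)
    have sb: "b + s < 1"
      using Nb(2) N_pos ab by (simp add: s_def field_simps)
    have hls: "h * (l * s) \<le> \<eta> / 2"
      using N\<eta> N_pos \<eta> by (simp add: s_def field_simps power2_eq_square)
    define S where "S i = cbox (plane_point (a + real i * s) b) (plane_point (a + real i * s + s) (b + s))" for i :: nat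
    have s2: "0 < s * s" using s0 by simp
    \<comment> \<open>Applied to the averages of \<open>\<rho>0\<close> over the squares:
      consecutive averages of the new density differ by at least \<open>h / 2\<close>.\<close>
    obtain t where t: "\<And>i. t i \<in> {0, h}"
      and osc: "\<And>i. h / 2 \<le> \<bar>(integral (S i) \<rho>0 / (s * s) + t i) - (integral (S (Suc i)) \<rho>0 / (s * s) + t (Suc i))\<bar>"
      using exists_oscillating_correction[OF h, of "\<lambda>i. integral (S i) \<rho>0 / (s * s)"] by blast
    define u' where "u' = overwrite_strip t a b l s u"
    have u': "u' \<in> borel_measurable lebesgue"
      using u(1) by (simp add: u'_def overwrite_strip_measurable)
    have u'_range: "u' x \<in> {0..h}" for x
      using u(2)[of x] t[of "nat \<lfloor>(x $ 1 - a) / s\<rfloor>"] h by (auto simp: u'_def overwrite_strip_def)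
    \<comment> \<open>The first bound preserves near realization of the old density; the second
      keeps \<open>2 * \<eta>'\<close> below the gap left in the comparison of adjacent
      squares.\<close>
    define \<eta>' where "\<eta>' = min (\<eta> / 2) (h * (s * s) / 16)"
    have \<eta>': "0 < \<eta>'" "\<eta>' \<le> \<eta> / 2" "\<eta>' \<le> h * (s * s) / 16"
      using \<eta> h s2 by (auto simp: \<eta>'_def)
    \<comment> \<open>Exactly the grid segments that occur in the hypothesis
      \<open>unstretched\<close> of \<open>exists_almost_translated_square\<close>.\<close>
    define T where "T = (\<lambda>(m, q). (a + real m * d, b + real q * d, s)) ` ({..(N - 1) * M} \<times> {..M})"
    have \<rho>_meas: "(\<lambda>x. \<rho>0 x + w x) \<in> borel_measurable lebesgue" if "w \<in> borel_measurable lebesgue" for w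
      using \<rho>0(1) that by (rule borel_measurable_add)
    have \<rho>_bound: "\<bar>\<rho>0 x + w x\<bar> \<le> C" if "w x \<in> {0..h}" for w x
      using \<rho>0(2)[of x] that by (auto simp: C_def)
    have integrable: "f integrable_on cbox c d"
      if "f \<in> borel_measurable lebesgue" "\<And>x. \<bar>f x\<bar> \<le> E" for f :: "real^2 \<Rightarrow> real" and c d E
      using bounded_measurable_absolutely_integrable_on[OF that, of "cbox c d"]
      by (auto dest: set_lebesgue_integral_eq_integral(1))
    have near: "nearly_realizes L (\<lambda>x. \<rho>0 x + u x) \<eta> g"
      if g: "nearly_realizes L (\<lambda>x. \<rho>0 x + u' x) \<eta>' g" for g
    proof (rule nearly_realizes_mono[OF g])
      fix c e :: "real^2"
      let ?S = "cbox (plane_point a b) (plane_point (a + l) (b + s))"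
      let ?f = "\<lambda>x. u' x - u x"
      have f: "?f \<in> borel_measurable lebesgue" "\<And>x. \<bar>?f x\<bar> \<le> h"
        using u u' u'_range by (auto simp: abs_le_iff) (smt (verit) atLeastAtMost_iff)+
      have "integral (cbox c e) (\<lambda>x. \<rho>0 x + u' x) - integral (cbox c e) (\<lambda>x. \<rho>0 x + u x) =
          integral (cbox c e) (\<lambda>x. (\<rho>0 x + u' x) - (\<rho>0 x + u x))"
        by (intro Henstock_Kurzweil_Integration.integral_diff[symmetric] integrable[of _ C]
            \<rho>_meas \<rho>_bound u u' u'_range)
      also have "\<dots> = integral (cbox c e) (\<lambda>x. if x \<in> ?S then ?f x else 0)"
        by (intro arg_cong[of _ _ "integral (cbox c e)"] ext) (simp add: u'_def overwrite_strip_def)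
      also have "\<dots> = integral (cbox c e \<inter> ?S) ?f"
        by (simp add: integral_restrict_Int Int_commute)
      finally have "\<bar>integral (cbox c e) (\<lambda>x. \<rho>0 x + u' x) - integral (cbox c e) (\<lambda>x. \<rho>0 x + u x)\<bar> \<le>
          h * measure lebesgue (cbox c e \<inter> ?S)"
        using abs_integral_le_measure[OF f, of "cbox c e \<inter> ?S"] by (simp add: fmeasurable.Int)
      also have "\<dots> \<le> h * measure lebesgue ?S"
        using h by (intro mult_left_mono measure_mono_fmeasurable) auto
      also have "\<dots> = h * (l * s)"
        using content_cbox_plane_point[of a "a + l" b "b + s"] ab s0 by simp
      finally show "\<bar>integral (cbox c e) (\<lambda>x. \<rho>0 x + u' x) - integral (cbox c e) (\<lambda>x. \<rho>0 x + u x)\<bar> \<le> \<eta> - \<eta>'"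
        using hls \<eta>'(2) by linarith
    qed
    have increased: "\<exists>p\<in>T. stretches g (A + \<kappa>) p"
      if g: "nearly_realizes L (\<lambda>x. \<rho>0 x + u' x) \<eta>' g"
        and stretches: "stretches g A (a, b, l)" for g
    proof (rule ccontr)
      have stretched: "A * l \<le> dist (g (plane_point a b)) (g (plane_point (a + l) b))"
        using stretches by (simp add: stretches_def)
      assume no: "\<not> ?thesis"
      have un: "dist (g (plane_point (a + m * d) (b + q * d))) (g (plane_point (a + m * d + s) (b + q * d)))
        \<le> (A + \<kappa>) * s" if "m \<le> (N - 1) * M" "q \<le> M" for m q :: nat
      proof -
        have "(a + m * d, b + q * d, s) \<in> T" using that by (auto simp: T_def)
        then show ?thesis using no by (fastforce simp: stretches_def)
      qed
      have small: "2 * (A + \<kappa>) * ((M + 1)\<^sup>2 * (2 * \<kappa> + 8 * L / N)) \<le> \<sigma>\<^sup>2"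
      proof -
        have "64 * L\<^sup>2 * K / N \<le> \<sigma>\<^sup>2"
          using NK N_pos \<sigma> by (simp add: field_simps)
        then have "8 * L * (K * \<kappa>) + 32 * L\<^sup>2 * K / N \<le> \<sigma>\<^sup>2" using \<kappa>K by linarith
        moreover have "8 * L * (K * \<kappa>) + 32 * L\<^sup>2 * K / N = 2 * (L + L) * (K * (2 * \<kappa> + 8 * L / N))"
          by (simp add: algebra_simps power2_eq_square)
        moreover have "2 * (A + \<kappa>) * (K * (2 * \<kappa> + 8 * L / N)) \<le> 2 * (L + L) * (K * (2 * \<kappa> + 8 * L / N))"
          using A \<open>\<kappa> \<le> L\<close> K \<kappa> L0 by (intro mult_right_mono mult_left_mono add_mono) auto
        ultimately have "2 * (A + \<kappa>) * (K * (2 * \<kappa> + 8 * L / N)) \<le> \<sigma>\<^sup>2" by linarith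
        moreover have "real ((M + 1)\<^sup>2) = K" by (simp add: K_def add.commute)
        ultimately show ?thesis by (simp only:)
      qed
      have gl: "bi_lipschitz_with L unit_square g" using g by (simp add: nearly_realizes_def)
      obtain i v where i: "i < N - 1" and close: "\<And>x. x \<in> S i \<Longrightarrow> dist (g x) (g (x + plane_point s 0) - v) \<le> 2 * \<sigma> * s"
        using exists_almost_translated_square[OF gl L N2 M1 ab(2) s_def d_def ab(1) ab(3) ab(4) less_imp_le[OF sb]
            A(1) \<kappa> stretched un less_imp_le[OF \<sigma>(1)] M\<sigma> small]
        unfolding S_def by blast
      have is0: "0 \<le> real i * s" using s0 by simp
      have isl: "real i * s + 2 * s \<le> l"
      proof -
        have "(real i + 2) * s \<le> real N * s"
          using i s0 by (intro mult_right_mono) auto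
        then show ?thesis using sN by (simp add: algebra_simps)
      qed
      have SucS: "S (Suc i) = cbox (plane_point (a + real i * s + s) b) (plane_point (a + real i * s + 2 * s) (b + s))"
        by (simp add: S_def algebra_simps)
      have "\<bar>integral (S i) (\<lambda>x. \<rho>0 x + u' x) - integral (S (Suc i)) (\<lambda>x. \<rho>0 x + u' x)\<bar>
          \<le> 8 * C * L * (2 * \<sigma> * s) * s + 2 * \<eta>'"
        unfolding SucS unfolding S_def
      proof (rule adjacent_squares_integral_close[OF g L \<rho>_meas[OF u'] \<rho>_bound[where w = u', OF u'_range]])
        show "4 * L * (2 * \<sigma> * s) \<le> s"
          using mult_right_mono[OF \<sigma>L, of s] s0 by (simp add: mult_ac)
      qed (use ab s0 is0 isl sb \<sigma> close in \<open>auto simp: S_def\<close>)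
      moreover have int_S: "integral (S j) (\<lambda>x. \<rho>0 x + u' x) = integral (S j) \<rho>0 + t j * (s * s)" if "j < N" for j
        unfolding S_def u'_def
        by (rule integral_overwrite_strip[OF s0 sN that integrable[OF \<rho>0]])
      moreover have "h / 2 * (s * s) \<le> \<bar>(integral (S i) \<rho>0 + t i * (s * s)) - (integral (S (Suc i)) \<rho>0 + t (Suc i) * (s * s))\<bar>"
      proof -
        have "h / 2 * (s * s) \<le> \<bar>(integral (S i) \<rho>0 / (s * s) + t i) - (integral (S (Suc i)) \<rho>0 / (s * s) + t (Suc i))\<bar> * \<bar>s * s\<bar>"
          using osc[of i] s2 by (intro mult_mono) auto
        also have "\<dots> = \<bar>(integral (S i) \<rho>0 + t i * (s * s)) - (integral (S (Suc i)) \<rho>0 + t (Suc i) * (s * s))\<bar>"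
          unfolding abs_mult[symmetric] using s0 by (simp add: left_diff_distrib distrib_right)
        finally show ?thesis .
      qed
      moreover have "8 * C * L * (2 * \<sigma> * s) * s = h / 4 * (s * s)"
        unfolding \<sigma>(3)[symmetric] by simp
      moreover have "i < N" "Suc i < N" using i by auto
      moreover have "0 < h * (s * s)" using h s2 by simp
      \<comment> \<open>In units of \<open>s * s\<close>, the oscillation is at least
        \<open>h / 2\<close>, but adjacent squares allow only \<open>h / 4 + h / 8\<close>.\<close>
      ultimately show False using \<eta>'(3) by simp
    qed
    have T_finite: "finite T" by (simp add: T_def)
    have T_sub: "T \<subseteq> horizontal_segments"
    proof -
      have "0 \<le> a + m * d" "a + m * d + s \<le> 1" "0 \<le> b + q * d" "b + q * d < 1"
        if mq: "m \<le> (N - 1) * M" "q \<le> M" for m q :: nat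
      proof -
        have "real m * d \<le> real ((N - 1) * M) * d"
          using mq(1) d0 by (intro mult_right_mono) (auto simp del: of_nat_mult)
        also have "\<dots> = real (N - 1) * (real M * d)" by simp
        also have "\<dots> = l - s" unfolding dM using sN N2 by (simp add: of_nat_diff algebra_simps)
        finally show "a + m * d + s \<le> 1" using ab by simp
        have "real q * d \<le> real M * d" using mq(2) d0 by simp
        then show "b + q * d < 1" using sb dM by linarith
      qed (use ab d0 in auto)
      then show ?thesis using s0 by (auto simp: T_def horizontal_segments_def)
    qed
    show "\<exists>u' \<eta>' T. u' \<in> borel_measurable lebesgue \<and> (\<forall>x. u' x \<in> {0..h}) \<and> 0 < \<eta>' \<and>
        finite T \<and> T \<subseteq> horizontal_segments \<and>
        (\<forall>g. nearly_realizes L (\<lambda>x. \<rho>0 x + u' x) \<eta>' g \<longrightarrow>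
          nearly_realizes L (\<lambda>x. \<rho>0 x + u x) \<eta> g \<and>
          (stretches g A (a, b, l) \<longrightarrow> (\<exists>p\<in>T. stretches g (A + \<kappa>) p)))"
      by (rule exI[of _ u'], rule exI[of _ \<eta>'], rule exI[of _ T], intro conjI allI impI)
        (fact u' u'_range \<eta>'(1) T_finite T_sub near increased)+
  qed
qed

subsection \<open>Enforcing large stretch factors\<close>

text \<open>Which segment is stretched depends on \<open>g\<close>, so a finite set of candidates is
  fixed before \<open>g\<close>; the next round can then treat them all. The bound \<open>h\<close>
  is the same for every \<open>A\<close>.\<close>

definition stretch_enforceable :: "(real^2 \<Rightarrow> real) \<Rightarrow> real \<Rightarrow> real \<Rightarrow> real \<Rightarrow> bool"
  where "stretch_enforceable \<rho>0 h L A \<longleftrightarrow>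
    (\<exists>u \<eta> T. u \<in> borel_measurable lebesgue \<and> (\<forall>x. u x \<in> {0..h}) \<and> 0 < \<eta> \<and>
      finite T \<and> T \<subseteq> horizontal_segments \<and>
      (\<forall>g. nearly_realizes L (\<lambda>x. \<rho>0 x + u x) \<eta> g \<longrightarrow> (\<exists>p\<in>T. stretches g A p)))"

lemma stretch_enforceable_0:
  assumes "0 < h"
  shows "stretch_enforceable \<rho>0 h L 0"
  unfolding stretch_enforceable_def
  by (rule exI[of _ "\<lambda>x. 0"], rule exI[of _ 1], rule exI[of _ "{(0, 0, 1)}"])
    (use assms in \<open>auto simp: stretches_def horizontal_segments_def\<close>)

lemma stretch_enforceable_increase:
  assumes \<rho>0: "\<rho>0 \<in> borel_measurable lebesgue" "\<And>x. \<bar>\<rho>0 x\<bar> \<le> B" and L: "L \<ge> 1" and h: "0 < h"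
  shows "\<exists>\<kappa>>0. \<forall>A. 0 \<le> A \<longrightarrow> A \<le> L \<longrightarrow>
    stretch_enforceable \<rho>0 h L A \<longrightarrow> stretch_enforceable \<rho>0 h L (A + \<kappa>)"
proof (rule increase_stretch_of_segment[OF assms])
  fix \<kappa> :: real
  assume \<kappa>: "0 < \<kappa>"
    and step:
    "\<And>u \<eta> a b l A. \<lbrakk>u \<in> borel_measurable lebesgue; \<And>x. u x \<in> {0..h}; 0 < \<eta>;
        (a, b, l) \<in> horizontal_segments; 0 \<le> A; A \<le> L\<rbrakk> \<Longrightarrow>
      \<exists>u' \<eta>' T. u' \<in> borel_measurable lebesgue \<and> (\<forall>x. u' x \<in> {0..h}) \<and> 0 < \<eta>' \<and>
        finite T \<and> T \<subseteq> horizontal_segments \<and>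
        (\<forall>g. nearly_realizes L (\<lambda>x. \<rho>0 x + u' x) \<eta>' g \<longrightarrow>
          nearly_realizes L (\<lambda>x. \<rho>0 x + u x) \<eta> g \<and>
          (stretches g A (a, b, l) \<longrightarrow> (\<exists>p\<in>T. stretches g (A + \<kappa>) p)))"
  \<comment> \<open>The segments are treated one at a time. A later modification is so thin that realizations of
    the new density still nearly realize all earlier ones, so overlapping strips do no harm.\<close>
  have all: "stretch_enforceable \<rho>0 h L (A + \<kappa>)"
    if "finite T" "0 \<le> A" "A \<le> L" "T \<subseteq> horizontal_segments" "finite T'" "T' \<subseteq> horizontal_segments"
      "u \<in> borel_measurable lebesgue" "\<And>x. u x \<in> {0..h}" "0 < \<eta>"
      "\<And>g. nearly_realizes L (\<lambda>x. \<rho>0 x + u x) \<eta> g \<Longrightarrow>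
        (\<exists>p\<in>T. stretches g A p) \<or> (\<exists>p\<in>T'. stretches g (A + \<kappa>) p)"
    for A T T' u \<eta>
    using that
  proof (induction T arbitrary: T' u \<eta> rule: finite_induct)
    case empty
    show ?case
      unfolding stretch_enforceable_def
      by (rule exI[of _ u], rule exI[of _ \<eta>], rule exI[of _ T']) (use empty in blast)
  next
    case (insert p T)
    obtain a b l where p: "p = (a, b, l)" by (cases p)
    have "(a, b, l) \<in> horizontal_segments" using insert.prems p by blast
    from step[OF insert.prems(6,7,8) this insert.prems(1,2)] obtain u1 \<eta>1 T1
      where 1: "u1 \<in> borel_measurable lebesgue" "\<And>x. u1 x \<in> {0..h}" "0 < \<eta>1" "finite T1"
        "T1 \<subseteq> horizontal_segments"
      and 2: "\<And>g. nearly_realizes L (\<lambda>x. \<rho>0 x + u1 x) \<eta>1 g \<Longrightarrow>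
          nearly_realizes L (\<lambda>x. \<rho>0 x + u x) \<eta> g \<and>
          (stretches g A p \<longrightarrow> (\<exists>p\<in>T1. stretches g (A + \<kappa>) p))"
      unfolding p by blast
    show ?case
    \<comment> \<open>A map that stretched \<open>p\<close> by \<open>A\<close> now stretches a
      member of \<open>T1\<close> by \<open>A + \<kappa>\<close>. The other alternatives survive
      because \<open>g\<close> still nearly realizes the previous density.\<close>
    proof (rule insert.IH[of "T' \<union> T1" u1 \<eta>1])
      fix g assume "nearly_realizes L (\<lambda>x. \<rho>0 x + u1 x) \<eta>1 g"
      from 2[OF this] insert.prems(9)[of g]
      show "(\<exists>p\<in>T. stretches g A p) \<or> (\<exists>p\<in>T' \<union> T1. stretches g (A + \<kappa>) p)" by blast
    qed (use insert.prems 1 in auto)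
  qed
  show ?thesis
  proof (intro exI[of _ \<kappa>] conjI allI impI \<kappa>)
    fix A assume A: "0 \<le> A" "A \<le> L" "stretch_enforceable \<rho>0 h L A"
    then obtain u \<eta> T where u: "u \<in> borel_measurable lebesgue" "\<And>x. u x \<in> {0..h}" "0 < \<eta>"
        "finite T" "T \<subseteq> horizontal_segments"
      and T: "\<And>g. nearly_realizes L (\<lambda>x. \<rho>0 x + u x) \<eta> g \<Longrightarrow> (\<exists>p\<in>T. stretches g A p)"
      unfolding stretch_enforceable_def by blast
    \<comment> \<open>At the start all of \<open>T\<close> is still to be treated and no short
      segments have been collected.\<close>
    show "stretch_enforceable \<rho>0 h L (A + \<kappa>)"
      by (rule all[of T A "{}" u \<eta>]) (use u T A in auto)
  qed
qed

text \<open>If every perturbation were nearly realized, no factor above \<open>L\<close> could be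
  enforced, by the Lipschitz bound. This same bound permits the next increase by
  \<open>\<kappa>\<close>, so all multiples of \<open>\<kappa>\<close> would be at most
  \<open>L\<close>.\<close>

lemma exists_unrealizable_perturbation:
  assumes \<rho>0: "\<rho>0 \<in> borel_measurable lebesgue" "\<And>x. \<bar>\<rho>0 x\<bar> \<le> B" and L: "L \<ge> 1" and h: "0 < h"
  shows "\<exists>u \<eta>. u \<in> borel_measurable lebesgue \<and> (\<forall>x. u x \<in> {0..h}) \<and> 0 < \<eta> \<and>
    (\<forall>g. \<not> nearly_realizes L (\<lambda>x. \<rho>0 x + u x) \<eta> g)"
proof (rule ccontr)
  assume no: "\<not> ?thesis"
  have le: "A \<le> L" if enforceable: "stretch_enforceable \<rho>0 h L A" for A
  proof -
    obtain u \<eta> T where u: "u \<in> borel_measurable lebesgue" "\<And>x. u x \<in> {0..h}" "0 < \<eta>"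
        "T \<subseteq> horizontal_segments"
      and T: "\<And>g. nearly_realizes L (\<lambda>x. \<rho>0 x + u x) \<eta> g \<Longrightarrow> (\<exists>p\<in>T. stretches g A p)"
      using enforceable unfolding stretch_enforceable_def by blast
    obtain g where g: "nearly_realizes L (\<lambda>x. \<rho>0 x + u x) \<eta> g" using no u by blast
    then obtain a b l where seg: "(a, b, l) \<in> horizontal_segments" and "stretches g A (a, b, l)"
      using T u(4) by fastforce
    then have "A * l \<le> dist (g (plane_point a b)) (g (plane_point (a + l) b))"
      by (simp add: stretches_def)
    also have "\<dots> \<le> L * dist (plane_point a b) (plane_point (a + l) b)"
      by (rule bi_lipschitz_withD(2)[of L unit_square])
        (use g L seg in \<open>auto simp: nearly_realizes_def horizontal_segments_def\<close>)
    also have "\<dots> \<le> L * l"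
      using dist_plane_point_le[of a b "a + l" b] seg L
      by (intro mult_left_mono) (auto simp: horizontal_segments_def)
    finally show "A \<le> L" using seg by (auto simp: horizontal_segments_def)
  qed
  obtain \<kappa> where \<kappa>: "0 < \<kappa>" and inc:
    "\<And>A. 0 \<le> A \<Longrightarrow> A \<le> L \<Longrightarrow> stretch_enforceable \<rho>0 h L A \<Longrightarrow> stretch_enforceable \<rho>0 h L (A + \<kappa>)"
    using stretch_enforceable_increase[OF assms] by blast
  have "stretch_enforceable \<rho>0 h L (real n * \<kappa>)" for n
  proof (induction n)
    case (Suc n)
    then show ?case using inc[OF _ le[OF Suc] Suc] \<kappa> by (simp add: algebra_simps)
  qed (use stretch_enforceable_0[OF h] in simp)
  then have "real n * \<kappa> \<le> L" for n using le by blast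
  moreover obtain n where "L < real n * \<kappa>" using reals_Archimedean3[OF \<kappa>] by blast
  ultimately show False by (meson not_le)
qed

subsection \<open>Jacobians as elements of the space of densities\<close>

text \<open>This is the change of variables formula for the injective map \<open>f\<close> off a
  null set; a Lipschitz map sends the exceptional null set to a null set. Positivity of
  \<open>\<sigma>\<close> removes the absolute value from the determinant.\<close>

lemma nearly_realizes_of_Jac:
  assumes f: "bi_lipschitz_with L unit_square f" and L: "L > 0"
    and \<sigma>: "\<sigma> \<in> borel_measurable lebesgue" "\<And>x. \<bar>\<sigma> x\<bar> \<le> D"
    and \<rho>: "\<rho> \<in> borel_measurable lebesgue" "\<And>x. \<bar>\<rho> x\<bar> \<le> C"
    and ae: "AE x in square_measure. f differentiable (at x within unit_square) \<and> Jac f x = \<sigma> x \<and>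
      0 < \<sigma> x \<and> \<bar>\<sigma> x - \<rho> x\<bar> \<le> \<eta>" and \<eta>: "0 \<le> \<eta>"
  shows "nearly_realizes L \<rho> \<eta> f"
  unfolding nearly_realizes_def
proof (intro conjI allI impI)
  fix a b :: "real^2" assume sub: "cbox a b \<subseteq> unit_square"
  have "AE x in lebesgue. x \<in> unit_square \<longrightarrow> f differentiable (at x within unit_square) \<and>
      Jac f x = \<sigma> x \<and> 0 < \<sigma> x \<and> \<bar>\<sigma> x - \<rho> x\<bar> \<le> \<eta>"
    using ae by (subst (asm) AE_restrict_space_iff) auto
  then obtain N where N: "negligible N"
    and good: "\<And>x. x \<in> unit_square - N \<Longrightarrow> f differentiable (at x within unit_square) \<and>
      Jac f x = \<sigma> x \<and> 0 < \<sigma> x \<and> \<bar>\<sigma> x - \<rho> x\<bar> \<le> \<eta>"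
    unfolding eventually_ae_filter_negligible by blast
  define S where "S = cbox a b - N"
  have SU: "S \<subseteq> unit_square - N" using sub by (auto simp: S_def)
  have NL: "N \<in> lmeasurable" using N by (simp add: negligible_imp_measurable)
  have S: "S \<in> lmeasurable" unfolding S_def using NL by (intro fmeasurable.Diff) auto
  have neg: "negligible (cbox a b \<inter> N)" using N by (simp add: negligible_Int)
  have int: "\<sigma> integrable_on S" "\<rho> integrable_on S"
    using bounded_measurable_absolutely_integrable_on[OF \<sigma> S]
      bounded_measurable_absolutely_integrable_on[OF \<rho> S]
    by (auto dest: set_lebesgue_integral_eq_integral(1))
  have det: "\<bar>det (matrix (frechet_derivative f (at x within unit_square)))\<bar> = \<sigma> x" if "x \<in> S" for x
    using good[of x] SU that by (auto simp: Jac_def)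
  have der: "(f has_derivative frechet_derivative f (at x within unit_square)) (at x within S)"
    if "x \<in> S" for x
    using good[of x] SU that
    by (auto simp: frechet_derivative_works intro: has_derivative_subset)
  have inj: "inj_on f S"
    using bi_lipschitz_with_inj_on[OF f L] SU by (auto intro: inj_on_subset)
  have int': "(\<lambda>x. \<bar>det (matrix (frechet_derivative f (at x within unit_square)))\<bar>) integrable_on S"
    using int(1) det by (simp cong: integrable_cong)
  have fS: "f ` S \<in> lmeasurable"
    using measurable_differentiable_image_eq[OF fmeasurableD[OF S] der inj] int' by blast
  have "measure lebesgue (f ` S) = integral S \<sigma>"
    using measure_differentiable_image_eq[OF fmeasurableD[OF S] der inj int'] det
    by (simp cong: Henstock_Kurzweil_Integration.integral_cong)
  moreover have "measure lebesgue (f ` cbox a b) = measure lebesgue (f ` S)"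
  proof (rule measure_negligible_symdiff[OF fS])
    have "negligible (f ` (cbox a b \<inter> N))"
    proof (rule negligible_locally_Lipschitz_image[OF order_refl neg])
      fix x assume "x \<in> cbox a b \<inter> N"
      then show "\<exists>T B. open T \<and> x \<in> T \<and> (\<forall>y\<in>(cbox a b \<inter> N) \<inter> T. norm (f y - f x) \<le> B * norm (y - x))"
        using bi_lipschitz_withD(2)[OF f L, unfolded dist_norm] sub
        by (intro exI[of _ UNIV] exI[of _ L]) auto
    qed
    then show "negligible (f ` S - f ` cbox a b \<union> (f ` cbox a b - f ` S))"
      by (rule negligible_subset) (auto simp: S_def)
  qed
  moreover have "integral (cbox a b) \<rho> = integral S \<rho>"
    by (rule integral_spike_set) (auto intro: negligible_subset[OF N] simp: S_def)
  moreover have "\<bar>integral S \<sigma> - integral S \<rho>\<bar> \<le> \<eta>"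
  proof -
    have "integral S \<sigma> - integral S \<rho> = integral S (\<lambda>x. \<sigma> x - \<rho> x)"
      by (rule Henstock_Kurzweil_Integration.integral_diff[symmetric]) (fact int)+
    also have "norm \<dots> \<le> integral S (\<lambda>x. \<eta>)"
    proof (rule Henstock_Kurzweil_Integration.integral_norm_bound_integral)
      show "(\<lambda>x. \<sigma> x - \<rho> x) integrable_on S"
        using int by (rule Henstock_Kurzweil_Integration.integrable_diff)
      show "(\<lambda>x. \<eta>) integrable_on S" using S by (rule integrable_on_const)
    qed (use good SU in auto)
    also have "\<dots> = \<eta> * measure lebesgue S"
      using lmeasure_integral[OF S] integral_mult_right[of S \<eta> "\<lambda>x. 1::real"] by simp
    \<comment> \<open>The unit square has area 1, so a pointwise error \<open>\<eta>\<close> gives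
      the same error for every box.\<close>
    also have "\<dots> \<le> \<eta> * measure lebesgue (cbox (plane_point 0 0) (plane_point 1 1))"
    proof (intro mult_left_mono measure_mono_fmeasurable \<eta>)
      show "S \<subseteq> cbox (plane_point 0 0) (plane_point 1 1)"
        using SU by (auto simp: cbox_plane_point unit_square_def)
    qed (use S in auto)
    finally show ?thesis using content_cbox_plane_point[of 0 1 0 1] by simp
  qed
  ultimately show "\<bar>measure lebesgue (f ` cbox a b) - integral (cbox a b) \<rho>\<bar> \<le> \<eta>" by simp
qed (fact f)

text \<open>The preceding results ask for measurability on the whole plane and a bound at every
  point. Truncating any representative at an essential bound and extending it by 0 provides
  both.\<close>

lemma linf_representative:
  "\<exists>r B. r \<in> borel_measurable lebesgue \<and> (\<forall>x. \<bar>r x\<bar> \<le> B) \<and> ess_bounded r \<and> \<rho> = abs_linf r"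
proof -
  define p where "p = rep_linf \<rho>"
  have p: "ess_bounded p" "abs_linf p = \<rho>"
    using Quotient_rep_reflp[OF Quotient_linf, of \<rho>] Quotient_abs_rep[OF Quotient_linf, of \<rho>]
    by (auto simp: p_def)
  then obtain B where B: "AE x in square_measure. \<bar>p x\<bar> \<le> B" by (auto simp: ess_bounded_iff)
  define c where "c = \<bar>B\<bar>"
  define r where "r x = (if x \<in> unit_square then max (- c) (min c (p x)) else 0)" for x
  have meas: "(\<lambda>x. max (- c) (min c (p x))) \<in> borel_measurable square_measure"
    using ess_bounded_measurable[OF p(1)] by measurable
  then have r: "r \<in> borel_measurable lebesgue"
    unfolding r_def[abs_def] by (simp add: borel_measurable_if)
  have bound: "\<bar>r x\<bar> \<le> c" for x by (auto simp: r_def c_def)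
  have eb: "ess_bounded r"
    unfolding ess_bounded_iff using measurable_restrict_space1[OF r, of unit_square] bound by auto
  have "AE x in square_measure. r x = p x"
    using B AE_space by eventually_elim (auto simp: r_def c_def space_restrict_space)
  then have "abs_linf r = abs_linf p"
    using p(1) eb by (intro Quotient_rel_abs[OF Quotient_linf]) auto
  with r bound eb p(2) show ?thesis
    by (intro exI[of _ r] exI[of _ c] conjI allI) simp_all
qed

text \<open>Corrections with values in \<open>{0..e / 2}\<close> preserve positivity and move the
  class by less than \<open>e\<close>. A Jacobian within \<open>\<eta>\<close> of the new density in
  norm would make its map nearly realize that density, so a whole ball is excluded.\<close>

lemma dense_nonrealizable_neighborhoods:
  assumes \<rho>: "\<rho> \<in> linf_pos" and e: "0 < e" and L: "L \<ge> 1"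
  obtains \<tau> \<eta> where "\<tau> \<in> linf_pos" "dist \<tau> \<rho> < e" "0 < \<eta>"
    "\<And>\<sigma> f. \<sigma> \<in> linf_pos \<Longrightarrow> dist \<sigma> \<tau> \<le> \<eta> \<Longrightarrow> bi_lipschitz_with L unit_square f \<Longrightarrow> \<not> has_Jac f \<sigma>"
proof -
  obtain r B where r: "r \<in> borel_measurable lebesgue" "\<And>x. \<bar>r x\<bar> \<le> B" "ess_bounded r" "\<rho> = abs_linf r"
    using linf_representative[of \<rho>] by blast
  have "0 < e / 2" using e by simp
  from exists_unrealizable_perturbation[OF r(1,2) L this] obtain u \<eta>
    where u: "u \<in> borel_measurable lebesgue" "\<And>x. u x \<in> {0..e / 2}" "0 < \<eta>"
      and none: "\<And>g. \<not> nearly_realizes L (\<lambda>x. r x + u x) \<eta> g"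
    by blast
  define t where "t x = r x + u x" for x
  have t: "t \<in> borel_measurable lebesgue" "\<And>x. \<bar>t x\<bar> \<le> B + e / 2"
  proof -
    show "t \<in> borel_measurable lebesgue"
      unfolding t_def[abs_def] using r(1) u(1) by (rule borel_measurable_add)
    show "\<bar>t x\<bar> \<le> B + e / 2" for x
      using r(2)[of x] u(2)[of x] by (auto simp: t_def)
  qed
  have tb: "ess_bounded t"
    unfolding ess_bounded_iff using measurable_restrict_space1[OF t(1), of unit_square] t(2) by auto
  have norm_diff: "norm (abs_linf p - abs_linf q) = ess_norm (\<lambda>x. p x - q x)"
    if "ess_bounded p" "ess_bounded q" for p q
    using that by (simp add: minus_linf.abs_eq norm_linf.abs_eq ess_bounded_diff)
  show ?thesis
  proof (rule that[of "abs_linf t" \<eta>])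
    have "AE x in square_measure. 0 < r x"
      using \<rho> r(3,4) by (simp add: linf_pos_def ae_positive.abs_eq)
    then have "AE x in square_measure. 0 < t x"
      by eventually_elim (use u(2) in \<open>auto simp: t_def intro: add_pos_nonneg\<close>)
    then show "abs_linf t \<in> linf_pos"
      using tb by (simp add: linf_pos_def ae_positive.abs_eq)
    have "ess_norm (\<lambda>x. t x - r x) \<le> e / 2"
      by (rule ess_norm_le[OF ess_bounded_diff[OF tb r(3)]]) (use u(2) in \<open>auto simp: t_def\<close>)
    then show "dist (abs_linf t) \<rho> < e"
      using e by (simp add: r(4) dist_norm norm_diff tb r(3))
    fix \<sigma> and f :: "real^2 \<Rightarrow> real^2"
    assume \<sigma>: "\<sigma> \<in> linf_pos" "dist \<sigma> (abs_linf t) \<le> \<eta>" and f: "bi_lipschitz_with L unit_square f"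
    show "\<not> has_Jac f \<sigma>"
    proof
      assume J: "has_Jac f \<sigma>"
      obtain s D where s: "s \<in> borel_measurable lebesgue" "\<And>x. \<bar>s x\<bar> \<le> D" "ess_bounded s" "\<sigma> = abs_linf s"
        using linf_representative[of \<sigma>] by blast
      have 1: "AE x in square_measure. f differentiable (at x within unit_square) \<and> Jac f x = s x"
        using J s(3,4) by (simp add: has_Jac.abs_eq)
      have 2: "AE x in square_measure. 0 < s x"
        using \<sigma>(1) s(3,4) by (simp add: linf_pos_def ae_positive.abs_eq)
      have "ess_norm (\<lambda>x. s x - t x) \<le> \<eta>"
        using \<sigma>(2) by (simp add: s(4) dist_norm norm_diff tb s(3))
      then have 3: "AE x in square_measure. \<bar>s x - t x\<bar> \<le> \<eta>"
        using ess_norm_AE[OF ess_bounded_diff[OF s(3) tb]] by (auto elim: eventually_mono)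
      have "nearly_realizes L t \<eta> f"
      proof (rule nearly_realizes_of_Jac[OF f _ s(1,2) t])
        show "AE x in square_measure. f differentiable (at x within unit_square) \<and> Jac f x = s x \<and>
            0 < s x \<and> \<bar>s x - t x\<bar> \<le> \<eta>"
          using 1 2 3 by eventually_elim auto
      qed (use L u(3) in auto)
      then show False using none by (simp add: t_def[abs_def])
    qed
  qed (fact u(3))
qed

section \<open>Assembling the open dense sets\<close>

theorem theorem2:
  shows "thick_in linf_pos C_infinity"
proof -
  \<comment> \<open>The shift to \<open>n + 1\<close> makes every constant at least 1, also for
    \<open>n = 0\<close>.\<close>
  define F where "F n = {\<sigma> \<in> linf_pos. \<exists>f. bi_lipschitz_with (real n + 1) unit_square f \<and> has_Jac f \<sigma>}" for n :: nat
  define U where "U n = linf_pos - closure (F n)" for n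
  have "C_infinity \<subseteq> linf_pos" by (auto simp: C_infinity_def)
  moreover have "openin (top_of_set linf_pos) (U n)" for n
  proof -
    have "U n = linf_pos \<inter> - closure (F n)" by (auto simp: U_def)
    then show ?thesis using openin_open_Int[OF open_Compl[OF closed_closure]] by simp
  qed
  moreover have "linf_pos \<subseteq> closure (U n)" for n
  proof
    fix \<rho> assume \<rho>: "\<rho> \<in> linf_pos"
    show "\<rho> \<in> closure (U n)"
      unfolding closure_approachable
    proof (intro allI impI)
      fix e :: real assume "0 < e"
      from dense_nonrealizable_neighborhoods[OF \<rho> this, of "real n + 1"] obtain \<tau> \<eta>
        where \<tau>: "\<tau> \<in> linf_pos" "dist \<tau> \<rho> < e" "0 < \<eta>"
          "\<And>\<sigma> f. \<sigma> \<in> linf_pos \<Longrightarrow> dist \<sigma> \<tau> \<le> \<eta> \<Longrightarrow>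
            bi_lipschitz_with (real n + 1) unit_square f \<Longrightarrow> \<not> has_Jac f \<sigma>"
        by auto
      \<comment> \<open>Otherwise some member of \<open>F n\<close> would lie within
        \<open>\<eta>\<close> of \<open>\<tau>\<close>.\<close>
      have "\<tau> \<notin> closure (F n)"
        unfolding closure_approachable F_def using \<tau>(3,4) by (force dest!: spec[of _ \<eta>] intro: less_imp_le)
      then show "\<exists>y\<in>U n. dist y \<rho> < e" using \<tau>(1,2) by (auto simp: U_def)
    qed
  qed
  moreover have "(\<Inter>n. U n) \<subseteq> C_infinity"
  proof
    fix \<rho> assume \<rho>: "\<rho> \<in> (\<Inter>n. U n)"
    have "\<not> has_Jac f \<rho>" if f: "bi_lipschitz_on unit_square f" for f
    proof
      assume J: "has_Jac f \<rho>"
      obtain L where L: "L \<ge> 1" "bi_lipschitz_with L unit_square f"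
        using f by (auto simp: bi_lipschitz_on_def)
      obtain n where "L \<le> real n" using real_arch_simple by blast
      then have "bi_lipschitz_with (real n + 1) unit_square f"
        using bi_lipschitz_with_mono[OF L(2)] L(1) by simp
      then have "\<rho> \<in> F n" using J \<rho> by (auto simp: F_def U_def)
      then show False using \<rho> closure_subset by (auto simp: U_def)
    qed
    then show "\<rho> \<in> C_infinity" using \<rho> by (auto simp: C_infinity_def U_def)
  qed
  ultimately show ?thesis unfolding thick_in_def by blast
qed

end
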